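(* a) Let $0<p<1$, $f\in H_p$ and $$\omega_{H_p}\left(\frac1{M_n},f\right)=o\left(\frac1{M_n^{1/p-1}}\right)\quad\text{when } n\to\infty .$$ Then $\|S_kf-f\|_{H_p}\to0$ when $k\to\infty$. b) For every $0<p<1$ there exists a martingale $f\in H_p$ for which $$\omega_{H_p}\left(\frac1{M_n},f\right)=O\left(\frac1{M_n^{1/p-1}}\right)\quad\text{when } n\to\infty$$ and $\|S_kf-f\|_{weak-L_p}\nrightarrow0$ when $k\to\infty$.
   Context: $\mathbb N_+$ is the set of positive integers, $\mathbb N=\mathbb N_+\cup\{0\}$. Fix a bounded sequence $m=(m_0,m_1,\dots)$ of integers $m_k\ge 2$. $G_m=\prod_{k\ge0}Z_{m_k}$, where $Z_{m_k}=\{0,\dots,m_k-1\}$ is the additive group modulo $m_k$, with the product of the discrete topologies; $\mu$ is the Haar measure with $\mu(G_m)=1$. $M_0:=1$, $M_{k+1}:=m_kM_k$; every $n\in\mathbb N$ is uniquely $n=\sum_{j\ge0}n_jM_j$ with $n_j\in Z_{m_j}$. $r_k(x):=\exp(2\pi i x_k/m_k)$, $\psi_n:=\prod_{k\ge0}r_k^{n_k}$ (Vilenkin system). $I_0(x):=G_m$, $I_n(x):=\{y: y_0=x_0,\dots,y_{n-1}=x_{n-1}\}$; $\mathcal F_n$ is the $\sigma$-algebra generated by $\{I_n(x):x\in G_m\}$. For $g\in L_1(G_m)$: $\widehat g(k):=\int g\overline{\psi_k}\,d\mu$, $S_ng:=\sum_{k=0}^{n-1}\widehat g(k)\psi_k$.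 A martingale is a sequence $f=(f^{(n)}:n\in\mathbb N)$ of integrable functions with $f^{(n)}$ $\mathcal F_n$-measurable and $S_{M_n}f^{(k)}=f^{(n)}$ for $n\le k$; $f^*:=\sup_n|f^{(n)}|$; $H_p$ is the set of martingales with $\|f\|_{H_p}:=\|f^*\|_p<\infty$, where $\|g\|_p:=(\int|g|^pd\mu)^{1/p}$ for functions. For a martingale, $\widehat f(i):=\lim_k\int f^{(k)}\overline{\psi_i}\,d\mu$ and $S_nf:=\sum_{k=0}^{n-1}\widehat f(k)\psi_k$. A function $g\in L_1$ is identified with the martingale $(S_{M_k}g:k\in\mathbb N)$; thus $S_nf-f$ is the martingale $(S_{M_k}S_nf-f^{(k)}:k\in\mathbb N)$. For functions $\|g\|_{weak-L_p}:=\sup_{\lambda>0}\lambda\,\mu(|g|>\lambda)^{1/p}$, and for martingales $\|f\|_{weak-L_p}:=\sup_n\|f^{(n)}\|_{weak-L_p}$. The modulus of continuity in $H_p$ is $\omega_{H_p}(1/M_n,f):=\|f-S_{M_n}f\|_{H_p}$. *)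

theory Defs
  imports "HOL-Probability.Probability"
begin

text \<open>Throughout, \<open>m\<close> is the generating sequence; all definitions are meant for \<open>m\<close> with
  \<open>m k \<ge> 2\<close>. A point of the group is a function \<open>x\<close> with \<open>x k < m k\<close> for all \<open>k\<close>; values of functions
  outside of \<open>Gm m\<close> are irrelevant.\<close>

definition generating_seq :: "(nat \<Rightarrow> nat) \<Rightarrow> bool" where
  "generating_seq m \<longleftrightarrow> (\<forall>k. 2 \<le> m k) \<and> (\<exists>B. \<forall>k. m k \<le> B)"

definition Gm :: "(nat \<Rightarrow> nat) \<Rightarrow> (nat \<Rightarrow> nat) set" where
  "Gm m = (\<Pi> k\<in>UNIV. {..<m k})"

text \<open>The normalised Haar measure, as the product of the uniform measures on the factors; see
  \<open>prob_space_haar\<close>, \<open>sets_haar\<close> (it lives on the Borel sets of the product topology) and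
  \<open>haar_translation_invariant\<close> below.\<close>

definition haar :: "(nat \<Rightarrow> nat) \<Rightarrow> (nat \<Rightarrow> nat) measure" where
  "haar m = (\<Pi>\<^sub>M k\<in>UNIV. uniform_count_measure {..<m k})"

primrec Mseq :: "(nat \<Rightarrow> nat) \<Rightarrow> nat \<Rightarrow> nat" where
  "Mseq m 0 = 1"
| "Mseq m (Suc k) = m k * Mseq m k"

text \<open>The digit \<open>n\<^sub>k\<close> of the expansion of \<open>n\<close> with respect to \<open>Mseq m\<close>; see \<open>digit_expansion\<close> and
  \<open>digit_unique\<close> below.\<close>

definition digit :: "(nat \<Rightarrow> nat) \<Rightarrow> nat \<Rightarrow> nat \<Rightarrow> nat" where
  "digit m n k = (n div Mseq m k) mod m k"

definition rademacher :: "(nat \<Rightarrow> nat) \<Rightarrow> nat \<Rightarrow> (nat \<Rightarrow> nat) \<Rightarrow> complex" where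
  "rademacher m k x = exp (2 * of_real pi * \<i> * of_nat (x k) / of_nat (m k))"

text \<open>All but finitely many digits vanish (\<open>finite_digits\<close>), so this is the full product over \<open>k\<close>.\<close>

definition vilenkin :: "(nat \<Rightarrow> nat) \<Rightarrow> nat \<Rightarrow> (nat \<Rightarrow> nat) \<Rightarrow> complex" where
  "vilenkin m n x = (\<Prod>k | digit m n k \<noteq> 0. rademacher m k x ^ digit m n k)"

definition cyl :: "(nat \<Rightarrow> nat) \<Rightarrow> nat \<Rightarrow> (nat \<Rightarrow> nat) \<Rightarrow> (nat \<Rightarrow> nat) set" where
  "cyl m n x = {y \<in> Gm m. \<forall>k<n. y k = x k}"

definition Filt :: "(nat \<Rightarrow> nat) \<Rightarrow> nat \<Rightarrow> (nat \<Rightarrow> nat) measure" where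
  "Filt m n = sigma (Gm m) (cyl m n ` Gm m)"

definition fourier_coeff :: "(nat \<Rightarrow> nat) \<Rightarrow> ((nat \<Rightarrow> nat) \<Rightarrow> complex) \<Rightarrow> nat \<Rightarrow> complex" where
  "fourier_coeff m g k = (\<integral>x. g x * cnj (vilenkin m k x) \<partial>haar m)"

definition partial_sum ::
    "(nat \<Rightarrow> nat) \<Rightarrow> nat \<Rightarrow> ((nat \<Rightarrow> nat) \<Rightarrow> complex) \<Rightarrow> (nat \<Rightarrow> nat) \<Rightarrow> complex" where
  "partial_sum m n g x = (\<Sum>k<n. fourier_coeff m g k * vilenkin m k x)"

text \<open>Both sides of the martingale identity are constant on the atoms of \<open>Filt m n\<close>, which have positive
  measure, so equality on all of \<open>Gm m\<close> and equality almost everywhere amount to the same.\<close>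

definition vilenkin_martingale ::
    "(nat \<Rightarrow> nat) \<Rightarrow> (nat \<Rightarrow> (nat \<Rightarrow> nat) \<Rightarrow> complex) \<Rightarrow> bool" where
  "vilenkin_martingale m f \<longleftrightarrow>
     (\<forall>n. integrable (haar m) (f n) \<and> f n \<in> borel_measurable (Filt m n)) \<and>
     (\<forall>n k. n \<le> k \<longrightarrow> (\<forall>x\<in>Gm m. partial_sum m (Mseq m n) (f k) x = f n x))"

definition mart_fourier_coeff ::
    "(nat \<Rightarrow> nat) \<Rightarrow> (nat \<Rightarrow> (nat \<Rightarrow> nat) \<Rightarrow> complex) \<Rightarrow> nat \<Rightarrow> complex" where
  "mart_fourier_coeff m f i = lim (\<lambda>k. fourier_coeff m (f k) i)"

definition mart_partial_sum ::
    "(nat \<Rightarrow> nat) \<Rightarrow> nat \<Rightarrow> (nat \<Rightarrow> (nat \<Rightarrow> nat) \<Rightarrow> complex) \<Rightarrow> (nat \<Rightarrow> nat) \<Rightarrow> complex" where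
  "mart_partial_sum m n f x = (\<Sum>k<n. mart_fourier_coeff m f k * vilenkin m k x)"

definition mart_of ::
    "(nat \<Rightarrow> nat) \<Rightarrow> ((nat \<Rightarrow> nat) \<Rightarrow> complex) \<Rightarrow> nat \<Rightarrow> (nat \<Rightarrow> nat) \<Rightarrow> complex" where
  "mart_of m g k = partial_sum m (Mseq m k) g"

text \<open>Powers of extended nonnegative numbers, for exponents \<open>p > 0\<close> only.\<close>

definition epowr :: "ennreal \<Rightarrow> real \<Rightarrow> ennreal" where
  "epowr a p = (if a = \<top> then \<top> else ennreal (enn2real a powr p))"

definition max_fun :: "(nat \<Rightarrow> (nat \<Rightarrow> nat) \<Rightarrow> complex) \<Rightarrow> (nat \<Rightarrow> nat) \<Rightarrow> ennreal" where
  "max_fun f x = (SUP n. ennreal (cmod (f n x)))"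

definition Lp_norm :: "(nat \<Rightarrow> nat) \<Rightarrow> real \<Rightarrow> ((nat \<Rightarrow> nat) \<Rightarrow> ennreal) \<Rightarrow> ennreal" where
  "Lp_norm m p g = epowr (\<integral>\<^sup>+x. epowr (g x) p \<partial>haar m) (1 / p)"

definition Hp_norm ::
    "(nat \<Rightarrow> nat) \<Rightarrow> real \<Rightarrow> (nat \<Rightarrow> (nat \<Rightarrow> nat) \<Rightarrow> complex) \<Rightarrow> ennreal" where
  "Hp_norm m p f = Lp_norm m p (max_fun f)"

definition Hp :: "(nat \<Rightarrow> nat) \<Rightarrow> real \<Rightarrow> (nat \<Rightarrow> (nat \<Rightarrow> nat) \<Rightarrow> complex) set" where
  "Hp m p = {f. vilenkin_martingale m f \<and> Hp_norm m p f < \<infinity>}"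

definition weak_Lp_norm ::
    "(nat \<Rightarrow> nat) \<Rightarrow> real \<Rightarrow> ((nat \<Rightarrow> nat) \<Rightarrow> complex) \<Rightarrow> ennreal" where
  "weak_Lp_norm m p g =
     (SUP t\<in>{0<..}. ennreal t * epowr (emeasure (haar m) {x \<in> Gm m. t < cmod (g x)}) (1 / p))"

definition mart_weak_Lp_norm ::
    "(nat \<Rightarrow> nat) \<Rightarrow> real \<Rightarrow> (nat \<Rightarrow> (nat \<Rightarrow> nat) \<Rightarrow> complex) \<Rightarrow> ennreal" where
  "mart_weak_Lp_norm m p f = (SUP n. weak_Lp_norm m p (f n))"

text \<open>\<open>Hp_modulus m p f n\<close> is the modulus of continuity of \<open>f\<close> at \<open>1 / Mseq m n\<close>.\<close>

definition Hp_modulus ::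
    "(nat \<Rightarrow> nat) \<Rightarrow> real \<Rightarrow> (nat \<Rightarrow> (nat \<Rightarrow> nat) \<Rightarrow> complex) \<Rightarrow> nat \<Rightarrow> ennreal" where
  "Hp_modulus m p f n = Hp_norm m p (f - mart_of m (mart_partial_sum m (Mseq m n) f))"

text \<open>The Landau symbols of the library are for functions into a normed field. These are the same notions
  for a sequence of extended nonnegative numbers on the left (as a consequence, the sequence is eventually
  finite).\<close>

definition ennreal_smallo :: "(nat \<Rightarrow> ennreal) \<Rightarrow> (nat \<Rightarrow> real) \<Rightarrow> bool" where
  "ennreal_smallo a b \<longleftrightarrow> (\<forall>c>0. \<forall>\<^sub>F n in sequentially. a n \<le> ennreal (c * \<bar>b n\<bar>))"

definition ennreal_bigo :: "(nat \<Rightarrow> ennreal) \<Rightarrow> (nat \<Rightarrow> real) \<Rightarrow> bool" where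
  "ennreal_bigo a b \<longleftrightarrow> (\<exists>c>0. \<forall>\<^sub>F n in sequentially. a n \<le> ennreal (c * \<bar>b n\<bar>))"

lemma Mseq_gt: "k < Mseq m k" if "generating_seq m"
proof (induction k)
  case (Suc k)
  have "2 * Mseq m k \<le> Mseq m (Suc k)"
    using that by (simp add: generating_seq_def)
  with Suc show ?case by linarith
qed simp

lemma digit_less: "digit m n k < m k" if "generating_seq m"
proof -
  have "2 \<le> m k" using that by (simp add: generating_seq_def)
  then show ?thesis by (simp add: digit_def)
qed

lemma digit_eq_0: "digit m n k = 0" if "generating_seq m" "n \<le> k"
  using Mseq_gt[OF that(1), of k] that(2) by (simp add: digit_def)

lemma digits_subset: "{k. digit m n k \<noteq> 0} \<subseteq> {..<n}" if "generating_seq m"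
proof
  fix k assume "k \<in> {k. digit m n k \<noteq> 0}"
  then have "\<not> n \<le> k" using digit_eq_0[OF that, of n k] by auto
  then show "k \<in> {..<n}" by simp
qed

lemma finite_digits: "finite {k. digit m n k \<noteq> 0}" if "generating_seq m"
  by (rule finite_subset[OF digits_subset[OF that]]) simp

lemma digit_expansion: "n = (\<Sum>j | digit m n j \<noteq> 0. digit m n j * Mseq m j)"
  if "generating_seq m"
proof -
  have *: "n mod Mseq m k = (\<Sum>j<k. digit m n j * Mseq m j)" for k
  proof (induction k)
    case (Suc k)
    have "n mod (Mseq m k * m k) = Mseq m k * (n div Mseq m k mod m k) + n mod Mseq m k"
      by (rule mod_mult2_eq)
    with Suc show ?case by (simp add: digit_def mult.commute)
  qed simp
  have "n = (\<Sum>j<n. digit m n j * Mseq m j)"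
    by (rule trans[OF mod_less[OF Mseq_gt[OF that], symmetric] *])
  also have "\<dots> = (\<Sum>j | digit m n j \<noteq> 0. digit m n j * Mseq m j)"
    by (rule sum.mono_neutral_right[OF _ digits_subset[OF that]]) simp_all
  finally show ?thesis .
qed

lemma digit_unique:
  assumes "generating_seq m" "\<And>j. d j < m j" "n = (\<Sum>j<N. d j * Mseq m j)" "k < N"
  shows "digit m n k = d k"
proof -
  have less: "(\<Sum>j<i. d j * Mseq m j) < Mseq m i" for i
  proof (induction i)
    case (Suc i)
    have "Suc (d i) * Mseq m i \<le> m i * Mseq m i"
      using assms(2)[of i] by (intro mult_right_mono) auto
    with Suc show ?case by simp
  qed simp
  have dvd: "Mseq m i dvd Mseq m j" if "i \<le> j" for i j
    using that by (induction rule: dec_induct) auto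
  have "(\<Sum>j\<in>{0..<Suc k}. d j * Mseq m j) + (\<Sum>j\<in>{Suc k..<N}. d j * Mseq m j) =
      (\<Sum>j\<in>{0..<N}. d j * Mseq m j)"
    by (rule sum.atLeastLessThan_concat) (use assms(4) in auto)
  then have n1: "n = (\<Sum>j<k. d j * Mseq m j) + d k * Mseq m k + (\<Sum>j\<in>{Suc k..<N}. d j * Mseq m j)"
    by (simp add: assms(3) atLeast0LessThan)
  have "Mseq m (Suc k) dvd (\<Sum>j\<in>{Suc k..<N}. d j * Mseq m j)"
    by (intro dvd_sum dvd_mult dvd) simp
  then obtain q where q: "(\<Sum>j\<in>{Suc k..<N}. d j * Mseq m j) = Mseq m (Suc k) * q"
    by (rule dvdE)
  have n: "n = (\<Sum>j<k. d j * Mseq m j) + Mseq m k * (d k + m k * q)"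
    unfolding n1 q by (simp add: algebra_simps)
  have "n div Mseq m k = d k + m k * q"
    unfolding n using less[of k] by (subst div_mult_self2) auto
  then show ?thesis using assms(2)[of k] by (simp add: digit_def)
qed

lemma space_haar: "space (haar m) = Gm m"
  by (simp add: haar_def Gm_def space_PiM PiE_def space_uniform_count_measure)

lemma prob_space_factor: "prob_space (uniform_count_measure {..<m k})" if "generating_seq m"
proof (rule prob_space_uniform_count_measure)
  have "2 \<le> m k" using that by (simp add: generating_seq_def)
  then show "{..<m k} \<noteq> {}" by (auto simp: lessThan_empty_iff)
qed simp

lemma prob_space_haar: "prob_space (haar m)" if "generating_seq m"
  unfolding haar_def by (intro prob_space_PiM prob_space_factor that)

lemma sets_haar: "sets (haar m) = sets (restrict_space borel (Gm m))"
proof -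
  have coord: "(\<lambda>x :: nat \<Rightarrow> nat. x k) \<in> measurable borel (count_space UNIV)" for k
  proof -
    have "measurable borel (borel :: nat measure) =
        measurable (borel :: (nat \<Rightarrow> nat) measure) (count_space UNIV)"
      by (rule measurable_cong_sets) (simp_all add: sets_borel_eq_count_space)
    then show ?thesis by (metis measurable_product_coordinates)
  qed
  have "(\<lambda>x. x) \<in> measurable (restrict_space borel (Gm m)) (haar m)"
    unfolding haar_def
  proof (rule measurable_PiM_single')
    fix k
    have "(\<lambda>x. x k) \<in> measurable (restrict_space borel (Gm m)) (restrict_space (count_space UNIV) {..<m k})"
      by (intro measurable_restrict_space3 coord) (auto simp: Gm_def)
    moreover have "sets (restrict_space (count_space UNIV) {..<m k}) =
        sets (uniform_count_measure {..<m k})"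
      by (auto simp: sets_restrict_space sets_uniform_count_measure image_iff)
    ultimately show "(\<lambda>x. x k) \<in> measurable (restrict_space borel (Gm m)) (uniform_count_measure {..<m k})"
      using measurable_cong_sets by blast
  qed (auto simp: space_restrict_space Gm_def space_uniform_count_measure)
  moreover have "(\<lambda>x. x) \<in> measurable (haar m) (restrict_space borel (Gm m))"
  proof (rule measurable_restrict_space2)
    show "(\<lambda>x. x) \<in> space (haar m) \<rightarrow> Gm m" by (simp add: space_haar)
    have "(\<lambda>x. x k) \<in> borel_measurable (haar m)" for k
    proof -
      have "(\<lambda>x. x k) \<in> measurable (haar m) (uniform_count_measure {..<m k})"
        unfolding haar_def by simp
      moreover have "(\<lambda>i. i) \<in> borel_measurable (uniform_count_measure {..<m k})"
        by (auto simp: measurable_def sets_uniform_count_measure space_uniform_count_measure)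
      ultimately show ?thesis by (rule measurable_compose)
    qed
    then show "(\<lambda>x. x) \<in> borel_measurable (haar m)"
      by (rule measurable_coordinatewise_then_product)
  qed
  ultimately show ?thesis
    by (intro antisym subsetI)
       (auto dest!: measurable_sets dest: sets.sets_into_space
         simp: space_haar space_restrict_space Int_absorb1 Int_absorb2)
qed

lemma haar_translation_invariant:
  assumes m: "generating_seq m" and a: "a \<in> Gm m"
  shows "distr (haar m) (haar m) (\<lambda>x k. (x k + a k) mod m k) = haar m"
proof -
  let ?U = "\<lambda>k. uniform_count_measure {..<m k}"
  let ?t = "\<lambda>k i. (i + a k) mod m k"
  interpret haar: prob_space "haar m" by (rule prob_space_haar[OF m])
  interpret product_prob_space ?U UNIV
    using prob_space_factor[OF m] by (intro product_prob_spaceI)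
  have pos: "0 < m k" for k
    using digit_less[OF m, of 0 k] by simp
  have t: "?t k \<in> measurable (?U k) (?U k)" for k
    using pos by (auto simp: measurable_def sets_uniform_count_measure space_uniform_count_measure)
  have tH: "(\<lambda>x k. ?t k (x k)) \<in> measurable (haar m) (haar m)"
    unfolding haar_def
  proof (rule measurable_PiM_single')
    fix k
    have "(\<lambda>x. x k) \<in> measurable (PiM UNIV ?U) (?U k)" by simp
    from measurable_compose[OF this t]
    show "(\<lambda>x. ?t k (x k)) \<in> measurable (PiM UNIV ?U) (?U k)" .
  qed (use pos in \<open>auto simp: space_uniform_count_measure\<close>)
  have surj: "{..<m k} \<subseteq> ?t k ` {..<m k}" for k
  proof
    fix j assume j: "j \<in> {..<m k}"
    have ak: "a k \<le> m k" using a by (auto simp: Gm_def Pi_iff intro: less_imp_le)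
    have "?t k ((j + (m k - a k)) mod m k) = (j + (m k - a k) + a k) mod m k"
      by (rule mod_add_left_eq)
    also have "\<dots> = j" using ak j by simp
    finally show "j \<in> ?t k ` {..<m k}"
      using pos[of k] by (metis imageI lessThan_iff mod_less_divisor)
  qed
  have bij: "bij_betw (?t k) {..<m k} {..<m k}" for k
    unfolding bij_betw_def using finite_surj_inj[OF _ surj, of k] surj[of k] pos[of k] by auto
  have fac: "emeasure (?U k) (?t k -` A \<inter> {..<m k}) = emeasure (?U k) A"
    if "A \<subseteq> {..<m k}" for k A
  proof -
    have "bij_betw (?t k) (?t k -` A \<inter> {..<m k}) A"
    proof (rule bij_betw_subset[OF bij])
      show "?t k ` (?t k -` A \<inter> {..<m k}) = A"
        using surj[of k] that by blast
    qed simp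
    then have "card (?t k -` A \<inter> {..<m k}) = card A" by (rule bij_betw_same_card)
    then show ?thesis
      using that by (simp add: emeasure_uniform_count_measure)
  qed
  have "distr (haar m) (haar m) (\<lambda>x k. ?t k (x k)) = PiM UNIV ?U"
  proof (rule PiM_eq)
    show "sets (distr (haar m) (haar m) (\<lambda>x k. ?t k (x k))) = sets (PiM UNIV ?U)"
      by (simp add: haar_def)
    fix J F assume J: "finite J" and F: "\<And>j. j \<in> J \<Longrightarrow> F j \<in> sets (?U j)"
    let ?E = "\<lambda>F. prod_emb UNIV ?U J (\<Pi>\<^sub>E j\<in>J. F j)"
    have sub: "F j \<subseteq> {..<m j}" if "j \<in> J" for j
      using F[OF that] by (simp add: sets_uniform_count_measure)
    have E: "?E F \<in> sets (haar m)"
      unfolding haar_def using J F by (intro sets_PiM_I) auto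
    have "(\<lambda>x k. ?t k (x k)) -` ?E F \<inter> space (haar m) = ?E (\<lambda>j. ?t j -` F j \<inter> {..<m j})"
      using pos by (auto simp: prod_emb_def space_haar Gm_def space_uniform_count_measure PiE_iff Pi_iff)
    then have "emeasure (distr (haar m) (haar m) (\<lambda>x k. ?t k (x k))) (?E F) =
        emeasure (PiM UNIV ?U) (?E (\<lambda>j. ?t j -` F j \<inter> {..<m j}))"
      using E by (simp add: emeasure_distr[OF tH]) (simp add: haar_def)
    also have "\<dots> = (\<Prod>j\<in>J. emeasure (?U j) (?t j -` F j \<inter> {..<m j}))"
      using J by (intro emeasure_PiM_emb) (auto simp: sets_uniform_count_measure)
    also have "\<dots> = (\<Prod>j\<in>J. emeasure (?U j) (F j))"
      using sub by (intro prod.cong fac refl)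
    finally show "emeasure (distr (haar m) (haar m) (\<lambda>x k. ?t k (x k))) (?E F) =
        (\<Prod>j\<in>J. emeasure (?U j) (F j))" .
  qed
  then show ?thesis by (simp add: haar_def)
qed

end

theory Submission
  imports Defs
begin

text \<open>
  Part a. If \<open>M\<^sub>N \<le> k < M\<^sub>N\<^sub>+\<^sub>1\<close>, then \<open>S\<^sub>k f - S\<^bsub>M\<^sub>N\<^esub> f = S\<^sub>k h\<close> for \<open>h = f\<^bsup>(N+1)\<^esup> - f\<^bsup>(N)\<^esup>\<close>, which is bounded by the
  maximal function of \<open>f - S\<^bsub>M\<^sub>N\<^esub> f\<close>. As \<open>h\<close> is constant on the cylinders of order \<open>N + 1\<close>, \<open>S\<^sub>k h\<close> is a finite
  combination of translates of the Dirichlet kernel \<open>D\<^sub>k\<close>, with coefficients \<open>h(r) / M\<^sub>N\<^sub>+\<^sub>1\<close>. Since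
  \<open>|D\<^sub>k| \<le> M\<^sub>s\<^sub>+\<^sub>1\<close> at points whose coordinate \<open>s\<close> is nonzero, \<open>\<integral>|D\<^sub>k|\<^sup>p\<close> is bounded in \<open>k\<close>, and the subadditivity of
  \<open>t\<^sup>p\<close> shows that \<open>\<integral>|S\<^sub>k h|\<^sup>p\<close> exceeds \<open>\<integral>|h|\<^sup>p\<close> by a factor of order \<open>M\<^sub>N\<^bsup>1-p\<^esup>\<close> at most.

  Part b. The unit mass at the origin, that is, the martingale of the kernels \<open>D\<^bsub>M\<^sub>n\<^esub> = M\<^sub>n 1\<^bsub>I\<^sub>n(0)\<^esub>\<close>, has all Fourier
  coefficients equal to \<open>1\<close>; outside of \<open>I\<^sub>n(0)\<close> its partial sum of order \<open>M\<^sub>n + 1\<close> reduces to a single character of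
  modulus \<open>1\<close>, while the martingale vanishes there from level \<open>n\<close> on.
\<close>

section \<open>Powers of extended nonnegative numbers\<close>

lemma epowr_top [simp]: "epowr \<top> p = \<top>"
  by (simp add: epowr_def)

lemma epowr_ennreal: "0 \<le> x \<Longrightarrow> epowr (ennreal x) p = ennreal (x powr p)"
  by (simp add: epowr_def)

lemma epowr_mono:
  assumes "0 \<le> p" "a \<le> b"
  shows "epowr a p \<le> epowr b p"
proof (cases b)
  case (real y)
  then obtain x where "0 \<le> x" "a = ennreal x" using assms(2) by (cases a) (auto simp: top_unique)
  with real assms show ?thesis
    by (auto simp: epowr_ennreal intro!: ennreal_leI powr_mono2)
qed simp

lemma epowr_inverse: "0 < p \<Longrightarrow> epowr (epowr a p) (1 / p) = a" "0 < p \<Longrightarrow> epowr (epowr a (1 / p)) p = a"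
  by (cases a; simp add: epowr_ennreal powr_powr)+

lemma epowr_le_iff:
  assumes "0 < p"
  shows "epowr a p \<le> c \<longleftrightarrow> a \<le> epowr c (1 / p)"
  using assms epowr_mono[of "1 / p" "epowr a p" c] epowr_mono[of p a "epowr c (1 / p)"]
  by (auto simp: epowr_inverse)

text \<open>After division by s = x + y both ratios lie in [0,1], where t \<le> t^p because p \<le>
  1; since the ratios add up to 1, so do their p-th powers to at least 1.\<close>

lemma powr_add_le:
  fixes x y p :: real
  assumes "0 \<le> x" "0 \<le> y" "0 < p" "p \<le> 1"
  shows "(x + y) powr p \<le> x powr p + y powr p"
proof (cases "x + y = 0")
  case False
  define s where "s = x + y"
  have s: "0 < s" using False assms by (simp add: s_def)
  have *: "z / s \<le> (z / s) powr p" if "0 \<le> z" "z \<le> s" for z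
  proof (cases "z = 0")
    case False
    then have "(z / s) powr 1 \<le> (z / s) powr p"
      using that s assms by (intro powr_mono') auto
    then show ?thesis using that s by simp
  qed simp
  have "1 = x / s + y / s" using s by (simp add: s_def add_divide_distrib[symmetric])
  also have "\<dots> \<le> (x / s) powr p + (y / s) powr p"
    using assms by (intro add_mono *) (auto simp: s_def)
  also have "\<dots> = (x powr p + y powr p) / s powr p"
    using assms s by (simp add: powr_divide add_divide_distrib)
  finally show ?thesis using s by (simp add: s_def field_simps)
qed (use assms in simp)

lemma epowr_add_le:
  assumes "0 < p" "p \<le> 1"
  shows "epowr (a + b) p \<le> epowr a p + epowr b p"
proof (cases a; cases b)
  fix x y assume "0 \<le> x" "a = ennreal x" "0 \<le> y" "b = ennreal y"
  then show ?thesis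
    using powr_add_le[of x y p] assms
    by (simp add: epowr_ennreal ennreal_plus[symmetric] ennreal_leI del: ennreal_plus)
qed simp_all

lemma norm_sum_powr_le:
  fixes f :: "'a \<Rightarrow> 'b :: real_normed_vector"
  assumes "0 < p" "p \<le> 1"
  shows "norm (\<Sum>i\<in>S. f i) powr p \<le> (\<Sum>i\<in>S. norm (f i) powr p)"
proof (induction S rule: infinite_finite_induct)
  case (insert i S)
  have "norm (f i + sum f S) powr p \<le> (norm (f i) + norm (sum f S)) powr p"
    using assms by (intro powr_mono2 norm_triangle_ineq) auto
  also have "\<dots> \<le> norm (f i) powr p + norm (sum f S) powr p"
    using assms by (intro powr_add_le) auto
  finally show ?case using insert by simp
qed simp_all

lemma measurable_epowr [measurable]: "(\<lambda>a. epowr a p) \<in> borel_measurable borel"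
  unfolding epowr_def by measurable

text \<open>Lets every norm estimate below be carried out on the integral of the p-th power, where
  subadditivity replaces the missing triangle inequality; the root is taken only at the end.\<close>

lemma Lp_norm_le_iff:
  "0 < p \<Longrightarrow> Lp_norm m p g \<le> epowr c (1 / p) \<longleftrightarrow> (\<integral>\<^sup>+x. epowr (g x) p \<partial>haar m) \<le> c"
  unfolding Lp_norm_def
  using epowr_mono[of "1/p"] epowr_mono[of p] epowr_inverse(2)
  by (metis divide_nonneg_nonneg less_eq_real_def zero_le_one)

text \<open>Taking p-th powers is an increasing bijection of [0,\<infinity>], so a bound that is
  uniform in \<open>n\<close> passes through the supremum.\<close>

lemma epowr_max_fun_le:
  assumes "0 < p" "\<And>n. ennreal (cmod (f n x) powr p) \<le> c"
  shows "epowr (max_fun f x) p \<le> c"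
proof -
  have "ennreal (cmod (f n x)) \<le> epowr c (1 / p)" for n
    using assms epowr_le_iff[of p "ennreal (cmod (f n x))" c] by (simp add: epowr_ennreal)
  then have "max_fun f x \<le> epowr c (1 / p)"
    unfolding max_fun_def by (rule SUP_least)
  then show ?thesis using assms(1) by (simp add: epowr_le_iff)
qed

lemma le_suminf_ennreal: "f i \<le> (\<Sum>i. f i :: ennreal)"
  using sum_le_suminf[OF summableI, of "{i}" f] by simp

lemma borel_measurable_cnj [measurable]: "cnj \<in> borel_measurable borel"
  by (intro borel_measurable_continuous_onI continuous_intros)

section \<open>Characters\<close>

lemma m_pos: "generating_seq m \<Longrightarrow> 0 < m k"
  by (metis digit_less gr_zeroI less_zeroE)

lemma Mseq_pos: "generating_seq m \<Longrightarrow> 0 < Mseq m k"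
  using Mseq_gt[of m k] by simp

lemma Mseq_dvd: "i \<le> j \<Longrightarrow> Mseq m i dvd Mseq m j"
  by (induction rule: dec_induct) auto

lemma Mseq_mono: "generating_seq m \<Longrightarrow> i \<le> j \<Longrightarrow> Mseq m i \<le> Mseq m j"
  using Mseq_dvd Mseq_pos by (simp add: dvd_imp_le)

lemma digit_less_Mseq: "generating_seq m \<Longrightarrow> n < Mseq m s \<Longrightarrow> s \<le> k \<Longrightarrow> digit m n k = 0"
  using Mseq_mono[of m s k] by (simp add: digit_def)

text \<open>No carry occurs. For k < s the number M_(k+1) divides a * M_s, so position k only sees
  \<open>b\<close>; for k \<ge> s the summand \<open>b\<close> disappears in the division by
  M_k.\<close>

lemma digit_block:
  assumes m: "generating_seq m" and b: "b < Mseq m s"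
  shows "digit m (a * Mseq m s + b) k = digit m (a * Mseq m s) k + digit m b k"
proof (cases "k < s")
  case True
  then obtain q where q: "Mseq m s = Mseq m (Suc k) * q"
    using Mseq_dvd[of "Suc k" s m] by (auto elim: dvdE)
  have 1: "a * Mseq m s = (a * m k * q) * Mseq m k"
    by (simp add: q)
  have "digit m (a * Mseq m s + b) k = (a * m k * q + b div Mseq m k) mod m k"
    unfolding digit_def 1 using Mseq_pos[OF m, of k] by simp
  also have "\<dots> = (b div Mseq m k + (a * q) * m k) mod m k"
    by (simp add: algebra_simps)
  also have "\<dots> = digit m b k" by (simp add: digit_def)
  finally have *: "digit m (a * Mseq m s + b) k = digit m b k" .
  have "digit m (a * Mseq m s) k = (a * q) * m k mod m k"
    unfolding digit_def 1 using Mseq_pos[OF m, of k] by (simp add: algebra_simps)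
  with * show ?thesis by simp
next
  case False
  then obtain q where q: "Mseq m k = Mseq m s * q"
    using Mseq_dvd[of s k m] by (auto elim: dvdE)
  have "(a * Mseq m s + b) div Mseq m k = a * Mseq m s div Mseq m k"
    using b Mseq_pos[OF m, of s] by (simp add: q div_mult2_eq)
  with False b m show ?thesis by (simp add: digit_less_Mseq) (simp add: digit_def)
qed

lemma digit_mult_Mseq:
  assumes m: "generating_seq m" and "a < m s"
  shows "digit m (a * Mseq m s) k = (if k = s then a else 0)"
proof -
  consider "k = s" | "k < s" | "s < k" by linarith
  then show ?thesis
  proof cases
    case 1
    then show ?thesis using assms Mseq_pos[OF m, of s] by (simp add: digit_def)
  next
    case 2
    then obtain q where q: "Mseq m s = Mseq m (Suc k) * q"
      using Mseq_dvd[of "Suc k" s m] by (auto elim: dvdE)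
    have 1: "a * Mseq m s = (a * q * m k) * Mseq m k"
      by (simp add: q)
    show ?thesis
      unfolding digit_def 1 using Mseq_pos[OF m, of k] 2 by simp
  next
    case 3
    have "a * Mseq m s < Mseq m (Suc s)" using assms Mseq_pos[OF m, of s] by simp
    then show ?thesis using 3 digit_less_Mseq[OF m, of _ "Suc s" k] by simp
  qed
qed

lemma vilenkin_eq_prod:
  assumes "generating_seq m" "n < Mseq m K"
  shows "vilenkin m n x = (\<Prod>k<K. rademacher m k x ^ digit m n k)"
  unfolding vilenkin_def
proof (rule prod.mono_neutral_left)
  show "{k. digit m n k \<noteq> 0} \<subseteq> {..<K}"
    using digit_less_Mseq[OF assms] by (metis (mono_tags) lessThan_iff mem_Collect_eq not_le subsetI)
qed auto

lemma vilenkin_block: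
  assumes m: "generating_seq m" and b: "b < Mseq m s"
  shows "vilenkin m (a * Mseq m s + b) x = vilenkin m (a * Mseq m s) x * vilenkin m b x"
proof -
  define K where "K = a * Mseq m s + b"
  have K: "a * Mseq m s + b < Mseq m K" unfolding K_def by (rule Mseq_gt[OF m])
  then show ?thesis
    using vilenkin_eq_prod[OF m, of "a * Mseq m s + b" K x] vilenkin_eq_prod[OF m, of "a * Mseq m s" K x]
      vilenkin_eq_prod[OF m, of b K x]
    by (simp add: digit_block[OF m b] power_add prod.distrib)
qed

lemma vilenkin_mult_Mseq:
  assumes m: "generating_seq m" and a: "a < m s"
  shows "vilenkin m (a * Mseq m s) x = rademacher m s x ^ a"
proof -
  have "a * Mseq m s < Mseq m (Suc s)" using a Mseq_pos[OF m, of s] by simp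
  from vilenkin_eq_prod[OF m this] show ?thesis
    by (simp add: digit_mult_Mseq[OF m a])
qed

lemma rademacher_eq_cis: "rademacher m k x = cis (2 * pi * real (x k) / real (m k))"
  by (simp add: rademacher_def cis_conv_exp mult_ac)

lemma norm_vilenkin [simp]: "cmod (vilenkin m n x) = 1"
  by (simp add: vilenkin_def rademacher_eq_cis prod_norm[symmetric] norm_power)

lemma vilenkin_zero_point [simp]: "vilenkin m n (\<lambda>_. 0) = 1"
  by (simp add: vilenkin_def rademacher_def)

lemma vilenkin_cong:
  assumes "generating_seq m" "i < Mseq m n" "\<And>k. k < n \<Longrightarrow> x k = y k"
  shows "vilenkin m i x = vilenkin m i y"
  using assms by (simp add: vilenkin_eq_prod rademacher_def)

text \<open>The product is \<open>cis\<close> of 2 pi (x_k - y_k) / m_k. It equals 1 only if m_k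
  divides x_k - y_k, and two residues below m_k differ by less than m_k.\<close>

lemma rademacher_eq_iff:
  assumes m: "generating_seq m" and x: "x \<in> Gm m" and y: "y \<in> Gm m"
  shows "rademacher m k x * cnj (rademacher m k y) = 1 \<longleftrightarrow> x k = y k"
proof
  assume *: "rademacher m k x * cnj (rademacher m k y) = 1"
  have "cis (2 * pi * (real (x k) - real (y k)) / real (m k)) = 1"
    using * by (simp add: rademacher_eq_cis cis_cnj cis_mult diff_divide_distrib algebra_simps)
  then have "cos (2 * pi * (real (x k) - real (y k)) / real (m k)) = 1"
    by (metis cis.sel(1) one_complex.sel(1))
  then obtain z :: int where "2 * pi * (real (x k) - real (y k)) / real (m k) = real_of_int z * 2 * pi"
    by (auto simp: cos_one_2pi_int)
  then have "pi * (real (x k) - real (y k) - real_of_int z * real (m k)) = 0"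
    using m_pos[OF m, of k] by (simp add: field_simps)
  then have "real (x k) - real (y k) = real_of_int z * real (m k)" by simp
  then have "real_of_int (int (x k) - int (y k)) = real_of_int (z * int (m k))" by simp
  then have z: "int (x k) - int (y k) = z * int (m k)" by (simp only: of_int_eq_iff)
  have "x k < m k" "y k < m k" using x y by (auto simp: Gm_def)
  then have "\<bar>z * int (m k)\<bar> < int (m k)" unfolding z[symmetric] by linarith
  then have "z = 0" using m_pos[OF m, of k] by (auto simp: abs_mult)
  with z show "x k = y k" by simp
next
  assume "x k = y k"
  then show "rademacher m k x * cnj (rademacher m k y) = 1"
    by (simp add: rademacher_eq_cis cis_cnj cis_mult)
qed

lemma rademacher_power:
  assumes "generating_seq m"
  shows "rademacher m k x ^ m k = 1"
proof -
  have "rademacher m k x ^ m k = cis (real (m k) * (2 * pi * real (x k) / real (m k)))"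
    unfolding rademacher_eq_cis by (rule Complex.DeMoivre)
  also have "\<dots> = cis (2 * pi * of_int (int (x k)))"
    using m_pos[OF assms, of k] by simp
  finally show ?thesis by (simp add: cis_multiple_2pi)
qed

section \<open>The Dirichlet kernel\<close>

text \<open>This is D_k(x - y) for the Dirichlet kernel D_k, written with two arguments so that no
  subtraction on the group has to be set up.\<close>

definition dkernel :: "(nat \<Rightarrow> nat) \<Rightarrow> nat \<Rightarrow> (nat \<Rightarrow> nat) \<Rightarrow> (nat \<Rightarrow> nat) \<Rightarrow> complex" where
  "dkernel m k x y = (\<Sum>i<k. vilenkin m i x * cnj (vilenkin m i y))"

text \<open>Cut the indices into \<open>q\<close> blocks of length M_s: on block \<open>a\<close>
  each character is the product of the one of index a * M_s and one of index b < M_s, so every block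
  is a multiple of the same kernel.\<close>

lemma dkernel_mult_Mseq:
  assumes "generating_seq m"
  shows "dkernel m (q * Mseq m s) x y =
    (\<Sum>a<q. vilenkin m (a * Mseq m s) x * cnj (vilenkin m (a * Mseq m s) y)) * dkernel m (Mseq m s) x y"
proof -
  have "dkernel m (q * Mseq m s) x y =
    (\<Sum>a<q. \<Sum>i\<in>{a * Mseq m s..<a * Mseq m s + Mseq m s}. vilenkin m i x * cnj (vilenkin m i y))"
    unfolding dkernel_def by (rule sum.nat_group[symmetric])
  also have "\<dots> = (\<Sum>a<q. \<Sum>b<Mseq m s. vilenkin m (a * Mseq m s + b) x * cnj (vilenkin m (a * Mseq m s + b) y))"
  proof (rule sum.cong[OF refl])
    fix a
    show "(\<Sum>i\<in>{a * Mseq m s..<a * Mseq m s + Mseq m s}. vilenkin m i x * cnj (vilenkin m i y)) =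
      (\<Sum>b<Mseq m s. vilenkin m (a * Mseq m s + b) x * cnj (vilenkin m (a * Mseq m s + b) y))"
      by (rule sum.reindex_bij_witness[where i="\<lambda>b. a * Mseq m s + b" and j="\<lambda>i. i - a * Mseq m s"]) auto
  qed
  also have "\<dots> = (\<Sum>a<q. \<Sum>b<Mseq m s. (vilenkin m (a * Mseq m s) x * cnj (vilenkin m (a * Mseq m s) y)) *
      (vilenkin m b x * cnj (vilenkin m b y)))"
    using assms by (intro sum.cong refl) (simp add: vilenkin_block)
  finally show ?thesis by (simp add: dkernel_def sum_product)
qed

text \<open>Each step of the induction multiplies by a geometric sum over an m_n-th root of unity
  \<open>w\<close>, which is m_n if w = 1 and vanishes otherwise; w = 1 means that the coordinates
  \<open>n\<close> agree.\<close>

lemma dkernel_Mseq: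
  assumes m: "generating_seq m" and x: "x \<in> Gm m" and y: "y \<in> Gm m"
  shows "dkernel m (Mseq m n) x y = (if \<forall>k<n. x k = y k then of_nat (Mseq m n) else 0)"
proof (induction n)
  case 0
  have "vilenkin m 0 z = 1" for z using vilenkin_eq_prod[OF m, of 0 0 z] by simp
  then show ?case by (simp add: dkernel_def)
next
  case (Suc n)
  define w where "w = rademacher m n x * cnj (rademacher m n y)"
  have "dkernel m (Mseq m (Suc n)) x y = (\<Sum>a<m n. w ^ a) * dkernel m (Mseq m n) x y"
    using dkernel_mult_Mseq[OF m, of "m n" n x y]
    by (simp add: vilenkin_mult_Mseq[OF m] w_def power_mult_distrib)
  moreover have "(\<Sum>a<m n. w ^ a) = (if x n = y n then of_nat (m n) else 0)"
  proof (cases "x n = y n")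
    case True
    then have "w = 1" using rademacher_eq_iff[OF m x y] by (simp add: w_def)
    with True show ?thesis by simp
  next
    case False
    then have "w \<noteq> 1" using rademacher_eq_iff[OF m x y] by (simp add: w_def)
    moreover have "w ^ m n = 1"
      using m by (simp add: w_def power_mult_distrib rademacher_power flip: complex_cnj_power)
    ultimately show ?thesis using False by (simp add: sum_gp_strict)
  qed
  ultimately show ?case using Suc by (auto simp: less_Suc_eq)
qed

lemma norm_dkernel_le: "cmod (dkernel m k x y) \<le> real k"
  unfolding dkernel_def by (rule order_trans[OF norm_sum]) (simp add: norm_mult)

text \<open>The complete blocks of length M_(s+1) cancel because \<open>x\<close> and
  \<open>y\<close> lie in different cylinders of order s + 1. Fewer than M_(s+1) terms of modulus 1
  remain.\<close>

lemma norm_dkernel_le_Mseq: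
  assumes m: "generating_seq m" and x: "x \<in> Gm m" and y: "y \<in> Gm m" and s: "x s \<noteq> y s"
  shows "cmod (dkernel m k x y) \<le> real (Mseq m (Suc s))"
proof -
  define M where "M = Mseq m (Suc s)"
  define q where "q = k div M"
  define t where "t i = vilenkin m i x * cnj (vilenkin m i y)" for i
  have M: "0 < M" unfolding M_def by (rule Mseq_pos[OF m])
  have k: "k = q * M + k mod M" by (simp add: q_def)
  have 0: "dkernel m (q * M) x y = 0"
    using s by (auto simp add: M_def dkernel_mult_Mseq[OF m] dkernel_Mseq[OF m x y] simp del: Mseq.simps)
  have "dkernel m k x y = (\<Sum>i<q * M + k mod M. t i)"
    using k by (simp add: dkernel_def t_def)
  also have "\<dots> = (\<Sum>i<q * M. t i) + (\<Sum>i\<in>{q * M..<q * M + k mod M}. t i)"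
    by (metis le_add1 lessThan_atLeast0 sum.atLeastLessThan_concat zero_le)
  also have "(\<Sum>i<q * M. t i) = 0" using 0 by (simp add: dkernel_def t_def)
  finally have "cmod (dkernel m k x y) \<le> (\<Sum>i\<in>{q * M..<q * M + k mod M}. cmod (t i))"
    by (simp add: norm_sum)
  also have "\<dots> = real (k mod M)" by (simp add: t_def norm_mult)
  also have "\<dots> \<le> real M" using M by (simp add: less_imp_le)
  finally show ?thesis by (simp add: M_def)
qed

section \<open>Integration over the group\<close>

locale vilenkin_system =
  fixes m :: "nat \<Rightarrow> nat"
  assumes m: "generating_seq m"
begin

sublocale haar: prob_space "haar m"
  by (rule prob_space_haar[OF m])

lemma zero_in_Gm: "(\<lambda>_. 0) \<in> Gm m"
  using m_pos[OF m] by (simp add: Gm_def)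

lemma digit_in_Gm: "digit m i \<in> Gm m"
  using digit_less[OF m] by (simp add: Gm_def)

lemma measurable_coordinate: "(\<lambda>x. x k) \<in> measurable (haar m) (uniform_count_measure {..<m k})"
  unfolding haar_def by simp

lemma measurable_vilenkin [measurable]: "vilenkin m n \<in> borel_measurable (haar m)"
proof -
  have "(\<lambda>i. exp (2 * of_real pi * \<i> * of_nat i / of_nat (m k)) :: complex)
      \<in> borel_measurable (uniform_count_measure {..<m k})" for k
    by (auto simp: measurable_def sets_uniform_count_measure space_uniform_count_measure)
  from measurable_compose[OF measurable_coordinate this]
  have [measurable]: "rademacher m k \<in> borel_measurable (haar m)" for k
    by (simp add: rademacher_def[abs_def])
  show ?thesis unfolding vilenkin_def[abs_def] by measurable
qed

lemma haar_cyl: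
  assumes y: "y \<in> Gm m"
  shows "cyl m n y \<in> sets (haar m)" "emeasure (haar m) (cyl m n y) = ennreal (1 / real (Mseq m n))"
proof -
  let ?U = "\<lambda>k. uniform_count_measure {..<m k}"
  interpret product_prob_space ?U UNIV
    using prob_space_factor[OF m] by (intro product_prob_spaceI)
  have yk: "y k < m k" for k using y by (auto simp: Gm_def)
  have eq: "cyl m n y = prod_emb UNIV ?U {..<n} (\<Pi>\<^sub>E j\<in>{..<n}. {y j})"
    by (auto simp: cyl_def prod_emb_def Gm_def space_uniform_count_measure PiE_iff Pi_iff)
  show "cyl m n y \<in> sets (haar m)"
    unfolding eq haar_def using yk by (intro sets_PiM_I) (auto simp: sets_uniform_count_measure)
  have "emeasure (haar m) (cyl m n y) = (\<Prod>j<n. emeasure (?U j) {y j})"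
    unfolding eq haar_def using yk by (intro emeasure_PiM_emb) (auto simp: sets_uniform_count_measure)
  also have "\<dots> = (\<Prod>j<n. ennreal (1 / real (m j)))"
    using yk m_pos[OF m] by (intro prod.cong refl) (simp add: emeasure_uniform_count_measure)
  also have "\<dots> = ennreal (\<Prod>j<n. 1 / real (m j))"
    by (rule prod_ennreal) simp
  also have "(\<Prod>j<n. 1 / real (m j)) = 1 / real (Mseq m n)"
    by (induction n) auto
  finally show "emeasure (haar m) (cyl m n y) = ennreal (1 / real (Mseq m n))" .
qed

lemma measure_cyl: "y \<in> Gm m \<Longrightarrow> measure (haar m) (cyl m n y) = 1 / real (Mseq m n)"
  by (simp add: measure_def haar_cyl)

section \<open>Translations and orthonormality of the characters\<close>

lemma vilenkin_translate:
  "vilenkin m n (\<lambda>k. (x k + a k) mod m k) = vilenkin m n x * vilenkin m n a"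
proof -
  have "rademacher m k (\<lambda>k. (x k + a k) mod m k) = rademacher m k x * rademacher m k a" for k
  proof -
    \<comment> \<open>The carry \<open>d\<close> of the addition modulo m_k changes the angle by
      \<open>d\<close> full turns only.\<close>
    define d where "d = (x k + a k) div m k"
    have "real (x k) + real (a k) = real (d * m k + (x k + a k) mod m k)"
      unfolding d_def div_mult_mod_eq by simp
    then have d: "real (x k) + real (a k) = real d * real (m k) + real ((x k + a k) mod m k)"
      by (simp only: of_nat_add of_nat_mult)
    have "2 * pi * real (x k) / real (m k) + 2 * pi * real (a k) / real (m k) =
        2 * pi / real (m k) * (real (x k) + real (a k))"
      by (simp add: distrib_left)
    then have e: "2 * pi * real (x k) / real (m k) + 2 * pi * real (a k) / real (m k) =
        2 * pi * of_int (int d) + 2 * pi * real ((x k + a k) mod m k) / real (m k)"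
      unfolding d using m_pos[OF m, of k] by (simp add: distrib_left)
    have "rademacher m k x * rademacher m k a =
        cis (2 * pi * real (x k) / real (m k) + 2 * pi * real (a k) / real (m k))"
      by (simp only: rademacher_eq_cis cis_mult)
    also have "\<dots> = cis (2 * pi * of_int (int d)) * rademacher m k (\<lambda>k. (x k + a k) mod m k)"
      unfolding e by (simp only: rademacher_eq_cis cis_mult)
    also have "cis (2 * pi * of_int (int d)) = 1" by (intro cis_multiple_2pi Ints_of_int)
    finally show ?thesis by simp
  qed
  then show ?thesis by (simp add: vilenkin_def power_mult_distrib prod.distrib)
qed

lemma measurable_translate:
  "(\<lambda>x k. (x k + a k) mod m k) \<in> measurable (haar m) (haar m)"
proof -
  have "(\<lambda>x k. (x k + a k) mod m k) \<in> measurable (haar m) (PiM UNIV (\<lambda>k. uniform_count_measure {..<m k}))"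
  proof (rule measurable_PiM_single')
    fix k
    have "(\<lambda>i. (i + a k) mod m k) \<in>
        measurable (uniform_count_measure {..<m k}) (uniform_count_measure {..<m k})"
      using m_pos[OF m] by (auto simp: measurable_def sets_uniform_count_measure space_uniform_count_measure)
    from measurable_compose[OF measurable_coordinate this]
    show "(\<lambda>x. (x k + a k) mod m k) \<in> measurable (haar m) (uniform_count_measure {..<m k})" .
  qed (use m_pos[OF m] in \<open>auto simp: space_uniform_count_measure\<close>)
  then show ?thesis by (simp add: haar_def)
qed

lemma integrable_vilenkin_mult: "integrable (haar m) (\<lambda>x. c * vilenkin m i x * cnj (vilenkin m j x))"
proof (rule haar.integrable_const_bound[where B="cmod c"])
  show "(\<lambda>x. c * vilenkin m i x * cnj (vilenkin m j x)) \<in> borel_measurable (haar m)" by measurable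
qed (simp add: norm_mult)

text \<open>Translating by the \<open>k\<close>-th unit vector multiplies the integral by a number that differs from \<open>1\<close> as soon
  as the \<open>k\<close>-th digits of \<open>i\<close> and \<open>j\<close> differ.\<close>

lemma vilenkin_orthonormal:
  "(\<integral>x. vilenkin m i x * cnj (vilenkin m j x) \<partial>haar m) = (if i = j then 1 else 0)"
proof (cases "i = j")
  case True
  have "vilenkin m i x * cnj (vilenkin m i x) = 1" for x
    by (simp flip: complex_norm_square)
  with True show ?thesis by (simp add: haar.prob_space)
next
  case False
  obtain k where k: "digit m i k \<noteq> digit m j k"
  proof (rule ccontr)
    assume "\<not> thesis"
    then have "digit m i = digit m j" using that by blast
    then have "i = j" using digit_expansion[OF m, of i] digit_expansion[OF m, of j] by simp
    with False show False ..
  qed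
  define a where "a j = (if j = k then 1 else 0 :: nat)" for j
  have a: "a \<in> Gm m"
    using m by (force simp: a_def Gm_def generating_seq_def intro: less_le_trans[of _ 2])
  \<comment> \<open>At the unit vector only the factor \<open>k\<close> survives. Reading the digit
    sequence of \<open>n\<close> as a point of the group, its value is a Rademacher function at that
    point, so \<open>rademacher_eq_iff\<close> can compare the digits of \<open>i\<close> and
    \<open>j\<close>.\<close>
  have va: "vilenkin m n a = rademacher m k (digit m n)" for n
  proof -
    obtain K where K: "n < Mseq m K" using Mseq_gt[OF m] by blast
    then have K': "n < Mseq m (max K (Suc k))"
      using Mseq_mono[OF m, of K "max K (Suc k)"] by linarith
    have "vilenkin m n a = (\<Prod>j<max K (Suc k). rademacher m j a ^ digit m n j)"
      by (rule vilenkin_eq_prod[OF m K'])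
    also have "\<dots> = (\<Prod>j\<in>{k}. rademacher m j a ^ digit m n j)"
      by (rule prod.mono_neutral_right) (auto simp: a_def rademacher_def)
    also have "\<dots> = cis (real (digit m n k) * (2 * pi * real (a k) / real (m k)))"
      by (simp only: prod.insert prod.empty finite.intros empty_iff not_False_eq_True mult_1_right
        rademacher_eq_cis Complex.DeMoivre)
    also have "\<dots> = rademacher m k (digit m n)"
      by (simp add: rademacher_eq_cis a_def mult_ac)
    finally show ?thesis .
  qed
  define F where "F x = vilenkin m i x * cnj (vilenkin m j x)" for x
  define w where "w = vilenkin m i a * cnj (vilenkin m j a)"
  have w: "w \<noteq> 1"
    unfolding w_def va using rademacher_eq_iff[OF m digit_in_Gm digit_in_Gm, of k i j] k by simp
  have [measurable]: "F \<in> borel_measurable (haar m)"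
    unfolding F_def[abs_def] by measurable
  have "integral\<^sup>L (haar m) F = integral\<^sup>L (distr (haar m) (haar m) (\<lambda>x k. (x k + a k) mod m k)) F"
    by (simp only: haar_translation_invariant[OF m a])
  also have "\<dots> = (\<integral>x. F (\<lambda>k. (x k + a k) mod m k) \<partial>haar m)"
    by (rule integral_distr[OF measurable_translate]) simp
  also have "\<dots> = (\<integral>x. w * F x \<partial>haar m)"
    by (simp add: F_def w_def vilenkin_translate mult_ac)
  also have "\<dots> = w * integral\<^sup>L (haar m) F" by simp
  finally have "(1 - w) * integral\<^sup>L (haar m) F = 0" by (simp add: algebra_simps)
  then have "integral\<^sup>L (haar m) F = 0" using w by simp
  then show ?thesis using False by (simp add: F_def[abs_def])
qed

section \<open>Fourier coefficients and partial sums of finite character sums\<close>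

lemma fourier_coeff_cong:
  "(\<And>x. x \<in> Gm m \<Longrightarrow> f x = g x) \<Longrightarrow> fourier_coeff m f i = fourier_coeff m g i"
  unfolding fourier_coeff_def by (rule Bochner_Integration.integral_cong) (auto simp: space_haar)

lemma fourier_coeff_sum:
  "fourier_coeff m (\<lambda>x. \<Sum>i<n. c i * vilenkin m i x) j = (if j < n then c j else 0)"
proof -
  have "fourier_coeff m (\<lambda>x. \<Sum>i<n. c i * vilenkin m i x) j =
      (\<integral>x. (\<Sum>i<n. c i * vilenkin m i x * cnj (vilenkin m j x)) \<partial>haar m)"
    by (simp add: fourier_coeff_def sum_distrib_right)
  also have "\<dots> = (\<Sum>i<n. \<integral>x. c i * vilenkin m i x * cnj (vilenkin m j x) \<partial>haar m)"
    by (rule Bochner_Integration.integral_sum) (rule integrable_vilenkin_mult)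
  also have "\<dots> = (\<Sum>i<n. if i = j then c i else 0)"
    by (intro sum.cong refl) (simp add: mult.assoc vilenkin_orthonormal)
  finally show ?thesis by simp
qed

lemma partial_sum_sum:
  "partial_sum m k (\<lambda>x. \<Sum>i<n. c i * vilenkin m i x) x = (\<Sum>i<min k n. c i * vilenkin m i x)"
proof -
  have "(\<Sum>i<k. (if i < n then c i else 0) * vilenkin m i x) = (\<Sum>i<min k n. c i * vilenkin m i x)"
    by (rule sum.mono_neutral_cong_right) auto
  then show ?thesis by (simp only: partial_sum_def fourier_coeff_sum)
qed

section \<open>Integrals of functions that depend on the first n coordinates only\<close>

definition reps :: "nat \<Rightarrow> (nat \<Rightarrow> nat) set" where
  "reps n = {x \<in> Gm m. \<forall>k\<ge>n. x k = 0}"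

lemma reps_in_Gm: "x \<in> reps n \<Longrightarrow> x \<in> Gm m"
  by (simp add: reps_def)

lemma finite_reps: "finite (reps n)"
proof -
  obtain b where b: "\<And>k. m k \<le> b" using m by (auto simp: generating_seq_def)
  have "reps n \<subseteq> {x. \<forall>k. (k \<in> {..<n} \<longrightarrow> x k \<in> {..<b}) \<and> (k \<notin> {..<n} \<longrightarrow> x k = 0)}"
    using b by (auto simp: reps_def Gm_def intro: less_le_trans)
  then show ?thesis by (rule finite_subset) (intro finite_set_of_finite_funs finite_lessThan)
qed

text \<open>The cylinders around the points of \<open>reps n\<close> partition the group, and the
  one containing \<open>x\<close> belongs to the truncation of \<open>x\<close> after
  \<open>n\<close> coordinates. Integrals of such functions thereby become finite sums with weight 1
  / M_n.\<close>

lemma sum_reps_eq: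
  fixes f :: "(nat \<Rightarrow> nat) \<Rightarrow> 'b :: comm_monoid_add"
  assumes x: "x \<in> Gm m" and f: "\<And>x y. x \<in> Gm m \<Longrightarrow> y \<in> Gm m \<Longrightarrow> \<forall>k<n. x k = y k \<Longrightarrow> f x = f y"
  shows "(\<Sum>r\<in>reps n. if x \<in> cyl m n r then f r else 0) = f x"
proof -
  define r where "r k = (if k < n then x k else 0)" for k
  have r: "r \<in> reps n" using x m_pos[OF m] by (auto simp: reps_def Gm_def r_def)
  have "x \<in> cyl m n s \<longleftrightarrow> s = r" if "s \<in> reps n" for s
    using that x by (auto simp: cyl_def reps_def r_def fun_eq_iff)
  then have "(\<Sum>s\<in>reps n. if x \<in> cyl m n s then f s else 0) = (\<Sum>s\<in>reps n. if s = r then f s else 0)"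
    by (intro sum.cong) auto
  also have "\<dots> = f r" using r finite_reps by simp
  also have "f r = f x" using r x by (intro f) (auto simp: r_def reps_def)
  finally show ?thesis .
qed

lemma nn_integral_eq_sum_reps:
  assumes "\<And>x y. x \<in> Gm m \<Longrightarrow> y \<in> Gm m \<Longrightarrow> \<forall>k<n. x k = y k \<Longrightarrow> f x = f y"
  shows "(\<integral>\<^sup>+x. f x \<partial>haar m) = (\<Sum>r\<in>reps n. f r) * ennreal (1 / real (Mseq m n))"
proof -
  have "(\<integral>\<^sup>+x. f x \<partial>haar m) = (\<integral>\<^sup>+x. (\<Sum>r\<in>reps n. f r * indicator (cyl m n r) x) \<partial>haar m)"
  proof (rule nn_integral_cong)
    fix x assume "x \<in> space (haar m)"
    then have "(\<Sum>r\<in>reps n. if x \<in> cyl m n r then f r else 0) = f x"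
      by (intro sum_reps_eq assms) (simp_all only: space_haar)
    moreover have "(if x \<in> cyl m n r then f r else 0) = f r * indicator (cyl m n r) x" for r
      by simp
    ultimately show "f x = (\<Sum>r\<in>reps n. f r * indicator (cyl m n r) x)"
      by simp
  qed
  also have "\<dots> = (\<Sum>r\<in>reps n. \<integral>\<^sup>+x. f r * indicator (cyl m n r) x \<partial>haar m)"
    by (rule nn_integral_sum) (use haar_cyl(1)[OF reps_in_Gm] in measurable)
  also have "\<dots> = (\<Sum>r\<in>reps n. f r * ennreal (1 / real (Mseq m n)))"
    by (intro sum.cong refl) (simp add: nn_integral_cmult_indicator haar_cyl reps_in_Gm)
  finally show ?thesis by (simp add: sum_distrib_right)
qed

lemma integral_eq_sum_reps:
  fixes f :: "(nat \<Rightarrow> nat) \<Rightarrow> complex"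
  assumes "\<And>x y. x \<in> Gm m \<Longrightarrow> y \<in> Gm m \<Longrightarrow> \<forall>k<n. x k = y k \<Longrightarrow> f x = f y"
  shows "(\<integral>x. f x \<partial>haar m) = (\<Sum>r\<in>reps n. f r) / of_nat (Mseq m n)"
proof -
  have "(\<integral>x. f x \<partial>haar m) = (\<integral>x. (\<Sum>r\<in>reps n. indicator (cyl m n r) x *\<^sub>R f r) \<partial>haar m)"
  proof (rule Bochner_Integration.integral_cong)
    fix x assume "x \<in> space (haar m)"
    then have "(\<Sum>r\<in>reps n. if x \<in> cyl m n r then f r else 0) = f x"
      by (intro sum_reps_eq assms) (simp_all only: space_haar)
    moreover have "(if x \<in> cyl m n r then f r else 0) = indicator (cyl m n r) x *\<^sub>R f r" for r
      by simp
    ultimately show "f x = (\<Sum>r\<in>reps n. indicator (cyl m n r) x *\<^sub>R f r)" by simp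
  qed simp
  also have "\<dots> = (\<Sum>r\<in>reps n. \<integral>x. indicator (cyl m n r) x *\<^sub>R f r \<partial>haar m)"
    by (rule Bochner_Integration.integral_sum)
       (simp add: haar_cyl reps_in_Gm haar.emeasure_eq_measure integrable_real_indicator integrable_scaleR_left)
  also have "\<dots> = (\<Sum>r\<in>reps n. f r / of_nat (Mseq m n))"
    using haar_cyl(1)[OF reps_in_Gm] sets.sets_into_space[OF haar_cyl(1)[OF reps_in_Gm]]
    by (intro sum.cong refl) (simp add: haar.emeasure_eq_measure measure_cyl reps_in_Gm scaleR_conv_of_real Int_absorb2)
  finally show ?thesis by (simp add: sum_divide_distrib)
qed

section \<open>Partial sums in \<open>L\<^sub>p\<close>\<close>

text \<open>As every m_k \<ge> 2, M_(n+s) \<ge> 2^s M_n. The exponent p - 1 is negative, so the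
  series is dominated by a geometric one of ratio 2^(p-1) < 1.\<close>

lemma suminf_Mseq_powr_le:
  assumes "p < 1"
  shows "(\<Sum>s. ennreal (real (Mseq m (n + s)) powr (p - 1))) \<le>
    ennreal (1 / (1 - 2 powr (p - 1)) * real (Mseq m n) powr (p - 1))"
proof -
  define q :: real where "q = 2 powr (p - 1)"
  have q: "0 < q" "q < 1" using assms by (auto simp: q_def intro: powr_less_one)
  have M: "2 ^ s * Mseq m n \<le> Mseq m (n + s)" for s
  proof (induction s)
    case (Suc s)
    have "2 * (2 ^ s * Mseq m n) \<le> m (n + s) * Mseq m (n + s)"
      using m Suc by (intro mult_mono) (auto simp: generating_seq_def)
    then show ?case by simp
  qed simp
  have "ennreal (real (Mseq m (n + s)) powr (p - 1)) \<le> ennreal (real (Mseq m n) powr (p - 1)) * ennreal (q ^ s)" for s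
  proof -
    have "real (Mseq m (n + s)) powr (p - 1) \<le> (2 ^ s * real (Mseq m n)) powr (p - 1)"
      using assms M[of s] Mseq_pos[OF m, of n] by (intro powr_mono2') (auto simp flip: of_nat_le_iff[where 'a=real])
    also have "\<dots> = (2 powr real s) powr (p - 1) * real (Mseq m n) powr (p - 1)"
      by (simp add: powr_mult powr_realpow)
    also have "(2 powr real s) powr (p - 1) = (2 powr (p - 1)) powr real s"
      by (simp only: powr_powr mult.commute)
    also have "\<dots> = q ^ s" using q by (simp add: q_def powr_realpow)
    finally have "ennreal (real (Mseq m (n + s)) powr (p - 1)) \<le> ennreal (real (Mseq m n) powr (p - 1) * q ^ s)"
      by (simp only: mult.commute ennreal_leI)
    then show ?thesis using q by (simp add: ennreal_mult)
  qed
  then have "(\<Sum>s. ennreal (real (Mseq m (n + s)) powr (p - 1))) \<le>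
      (\<Sum>s. ennreal (real (Mseq m n) powr (p - 1)) * ennreal (q ^ s))"
    by (intro suminf_le) auto
  also have "\<dots> = ennreal (real (Mseq m n) powr (p - 1)) * (\<Sum>s. ennreal (q ^ s))" by simp
  also have "(\<Sum>s. ennreal (q ^ s)) = ennreal (1 / (1 - q))"
    using q by (subst suminf_ennreal2) (auto simp: suminf_geometric summable_geometric)
  also have "ennreal (real (Mseq m n) powr (p - 1)) * ennreal (1 / (1 - q)) =
      ennreal (1 / (1 - q) * real (Mseq m n) powr (p - 1))"
    using q by (subst mult.commute, intro ennreal_mult[symmetric]) auto
  finally show ?thesis by (simp only: q_def)
qed

text \<open>If \<open>s\<close> is the first coordinate in which \<open>x\<close> and
  \<open>y\<close> differ, then \<open>x\<close> lies in I_s(y) and |D_k| \<le> M_(s+1) \<le> b M_s.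
  As I_s(y) has measure 1 / M_s, summation over \<open>s\<close> leaves a convergent series of terms
  b^p M_s^(p-1), whose bound is independent of \<open>k\<close>.\<close>

lemma nn_integral_dkernel_le:
  assumes p: "0 < p" "p < 1" and b: "\<And>k. m k \<le> b" and y: "y \<in> Gm m"
  shows "(\<integral>\<^sup>+x. ennreal (cmod (dkernel m k x y) powr p) \<partial>haar m) \<le>
    ennreal (real b powr p / (1 - 2 powr (p - 1)))"
proof -
  have pw: "ennreal (cmod (dkernel m k x y) powr p) \<le>
      (\<Sum>s. ennreal (real (Mseq m (Suc s)) powr p) * indicator (cyl m s y) x)" (is "_ \<le> ?R x") if x: "x \<in> Gm m" for x
  proof -
    obtain s where s: "x \<in> cyl m s y" "cmod (dkernel m k x y) \<le> real (Mseq m (Suc s))"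
    proof (cases "x = y")
      \<comment> \<open>Here \<open>x\<close> lies in every cylinder around \<open>y\<close>; s = k
        is a choice for which the trivial bound k suffices, since k < M_(k+1).\<close>
      case True
      have "cmod (dkernel m k x y) \<le> real (Mseq m (Suc k))"
        using norm_dkernel_le[of m k x y] Mseq_gt[OF m, of "Suc k"] by linarith
      then show ?thesis using True x that[of k] by (simp add: cyl_def)
    next
      case False
      define s where "s = (LEAST s. x s \<noteq> y s)"
      have ex: "\<exists>s. x s \<noteq> y s" using False by auto
      have "x s \<noteq> y s" unfolding s_def using ex by (rule LeastI_ex)
      moreover have "x \<in> cyl m s y"
        unfolding cyl_def s_def using x not_less_Least[of _ "\<lambda>s. x s \<noteq> y s"] by blast
      ultimately show ?thesis using that norm_dkernel_le_Mseq[OF m x y] by blast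
    qed
    have "ennreal (cmod (dkernel m k x y) powr p) \<le> ennreal (real (Mseq m (Suc s)) powr p) * indicator (cyl m s y) x"
      using s p by (simp add: ennreal_leI powr_mono2 del: Mseq.simps)
    also have "\<dots> \<le> ?R x" by (rule le_suminf_ennreal)
    finally show ?thesis .
  qed
  have "(\<integral>\<^sup>+x. ennreal (cmod (dkernel m k x y) powr p) \<partial>haar m) \<le>
      (\<integral>\<^sup>+x. (\<Sum>s. ennreal (real (Mseq m (Suc s)) powr p) * indicator (cyl m s y) x) \<partial>haar m)"
    by (rule nn_integral_mono) (simp only: space_haar pw)
  also have "\<dots> = (\<Sum>s. \<integral>\<^sup>+x. ennreal (real (Mseq m (Suc s)) powr p) * indicator (cyl m s y) x \<partial>haar m)"
    by (rule nn_integral_suminf) (use haar_cyl(1)[OF y] in measurable)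
  also have "\<dots> = (\<Sum>s. ennreal (real (Mseq m (Suc s)) powr p / real (Mseq m s)))"
    by (intro suminf_cong)
       (simp add: nn_integral_cmult_indicator haar_cyl[OF y] ennreal_mult[symmetric] del: Mseq.simps)
  also have "\<dots> \<le> (\<Sum>s. ennreal (real b powr p) * ennreal (real (Mseq m (0 + s)) powr (p - 1)))"
  proof (intro suminf_le)
    fix s
    have "real (Mseq m (Suc s)) powr p \<le> (real b * real (Mseq m s)) powr p"
      using p b[of s] by (intro powr_mono2) (auto intro!: mult_right_mono)
    then have "real (Mseq m (Suc s)) powr p / real (Mseq m s) \<le> real b powr p * (real (Mseq m s) powr p / real (Mseq m s))"
      using Mseq_pos[OF m, of s] by (simp add: powr_mult divide_simps)
    then show "ennreal (real (Mseq m (Suc s)) powr p / real (Mseq m s)) \<le>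
        ennreal (real b powr p) * ennreal (real (Mseq m (0 + s)) powr (p - 1))"
      using Mseq_pos[OF m, of s] by (simp add: powr_diff ennreal_leI ennreal_mult[symmetric])
  qed auto
  also have "\<dots> = ennreal (real b powr p) * (\<Sum>s. ennreal (real (Mseq m (0 + s)) powr (p - 1)))"
    by simp
  also have "\<dots> \<le> ennreal (real b powr p) * ennreal (1 / (1 - 2 powr (p - 1)) * real (Mseq m 0) powr (p - 1))"
    by (intro mult_left_mono suminf_Mseq_powr_le p) simp
  also have "\<dots> = ennreal (real b powr p / (1 - 2 powr (p - 1)))"
    using powr_less_one[of 2 "p - 1"] p by (subst ennreal_mult[symmetric]) auto
  finally show ?thesis .
qed

text \<open>The polynomial \<open>P\<close> of order M_n depends on \<open>n\<close> coordinates
  only, so its coefficients are averages over \<open>reps n\<close> and its k-th partial sum is the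
  average of P(r) D_k(x - r). Subadditivity of the p-th power separates the summands, and each
  kernel has a uniformly bounded integral.\<close>

lemma nn_integral_partial_sum_le:
  assumes p: "0 < p" "p < 1" and b: "\<And>k. m k \<le> b" and k: "k \<le> Mseq m n"
  shows "(\<integral>\<^sup>+x. ennreal (cmod (\<Sum>i<k. c i * vilenkin m i x) powr p) \<partial>haar m) \<le>
    ennreal (real b powr p / (1 - 2 powr (p - 1)) * real (Mseq m n) powr (1 - p)) *
    (\<integral>\<^sup>+x. ennreal (cmod (\<Sum>i<Mseq m n. c i * vilenkin m i x) powr p) \<partial>haar m)"
proof -
  define P where "P x = (\<Sum>i<Mseq m n. c i * vilenkin m i x)" for x
  define M where "M = real (Mseq m n)"
  define C where "C = real b powr p / (1 - 2 powr (p - 1))"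
  have M: "0 < M" using Mseq_pos[OF m, of n] by (simp add: M_def)
  have C: "0 \<le> C" using powr_less_one[of 2 "p - 1"] p by (simp add: C_def)
  have P: "P x = P y" if "\<forall>k<n. x k = y k" for x y
    unfolding P_def using that by (intro sum.cong refl arg_cong2[where f="(*)"] vilenkin_cong[OF m]) auto
  have coeff: "c i = (\<Sum>r\<in>reps n. P r * cnj (vilenkin m i r)) / of_nat (Mseq m n)" if "i < Mseq m n" for i
  proof -
    have "c i = fourier_coeff m P i"
      using that by (simp add: P_def[abs_def] fourier_coeff_sum)
    also have "\<dots> = (\<Sum>r\<in>reps n. P r * cnj (vilenkin m i r)) / of_nat (Mseq m n)"
      unfolding fourier_coeff_def using that
      by (intro integral_eq_sum_reps arg_cong2[where f="(*)"] P arg_cong[where f=cnj] vilenkin_cong[OF m]) auto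
    finally show ?thesis .
  qed
  have "(\<Sum>i<k. c i * vilenkin m i x) = (\<Sum>r\<in>reps n. P r * dkernel m k x r / of_nat (Mseq m n))" for x
  proof -
    have "(\<Sum>i<k. c i * vilenkin m i x) =
        (\<Sum>i<k. \<Sum>r\<in>reps n. P r * (vilenkin m i x * cnj (vilenkin m i r)) / of_nat (Mseq m n))"
      using k by (intro sum.cong refl) (simp add: coeff sum_distrib_right sum_distrib_left sum_divide_distrib mult_ac)
    also have "\<dots> = (\<Sum>r\<in>reps n. \<Sum>i<k. P r * (vilenkin m i x * cnj (vilenkin m i r)) / of_nat (Mseq m n))"
      by (rule sum.swap)
    finally show ?thesis by (simp add: dkernel_def sum_distrib_left sum_divide_distrib)
  qed
  then have pw: "cmod (\<Sum>i<k. c i * vilenkin m i x) powr p \<le>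
      (\<Sum>r\<in>reps n. M powr (- p) * cmod (P r) powr p * cmod (dkernel m k x r) powr p)" for x
    using norm_sum_powr_le[of p "\<lambda>r. P r * dkernel m k x r / of_nat (Mseq m n)" "reps n"] p
    by (simp add: norm_mult norm_divide powr_mult powr_divide powr_minus_divide M_def)
  have meas: "(\<lambda>x. dkernel m k x r) \<in> borel_measurable (haar m)" for r
    unfolding dkernel_def by measurable
  have "(\<integral>\<^sup>+x. ennreal (cmod (\<Sum>i<k. c i * vilenkin m i x) powr p) \<partial>haar m) \<le>
      (\<integral>\<^sup>+x. (\<Sum>r\<in>reps n. ennreal (M powr (- p) * cmod (P r) powr p) * ennreal (cmod (dkernel m k x r) powr p)) \<partial>haar m)"
    by (intro nn_integral_mono) (simp add: sum_ennreal ennreal_leI pw flip: ennreal_mult)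
  also have "\<dots> = (\<Sum>r\<in>reps n. ennreal (M powr (- p) * cmod (P r) powr p) *
      (\<integral>\<^sup>+x. ennreal (cmod (dkernel m k x r) powr p) \<partial>haar m))"
    using meas by (simp add: nn_integral_sum nn_integral_cmult)
  also have "\<dots> \<le> (\<Sum>r\<in>reps n. ennreal (M powr (- p) * cmod (P r) powr p) * ennreal C)"
    unfolding C_def by (intro sum_mono mult_left_mono nn_integral_dkernel_le p b reps_in_Gm) auto
  \<comment> \<open>Subadditivity has turned the averaging factor 1/M into M^(-p). Splitting off
    1/M, which restores the integral of |P|^p, leaves the loss M^(1-p).\<close>
  also have "\<dots> = (\<Sum>r\<in>reps n. ennreal (cmod (P r) powr p) * (ennreal (C * M powr (1 - p)) * ennreal (1 / M)))"
    using C M by (intro sum.cong refl) (simp add: powr_diff powr_minus_divide field_simps flip: ennreal_mult)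
  also have "\<dots> = ennreal (C * M powr (1 - p)) * ((\<Sum>r\<in>reps n. ennreal (cmod (P r) powr p)) * ennreal (1 / M))"
    by (simp only: sum_distrib_right sum_distrib_left mult_ac)
  also have "(\<Sum>r\<in>reps n. ennreal (cmod (P r) powr p)) * ennreal (1 / M) =
      (\<integral>\<^sup>+x. ennreal (cmod (P x) powr p) \<partial>haar m)"
    unfolding M_def by (rule nn_integral_eq_sum_reps[symmetric]) (drule P, simp)
  finally show ?thesis by (simp only: P_def C_def M_def)
qed

section \<open>Martingales\<close>

text \<open>The level \<open>n\<close> is the partial sum of order M_n of every later level, so the
  i-th coefficients are constant from level \<open>n\<close> on and the limit is attained.\<close>

lemma fourier_coeff_martingale:
  assumes f: "vilenkin_martingale m f" and i: "i < Mseq m n"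
  shows "fourier_coeff m (f n) i = mart_fourier_coeff m f i"
proof -
  have "fourier_coeff m (f k) i = fourier_coeff m (f n) i" if "n \<le> k" for k
  proof -
    have "f n x = (\<Sum>j<Mseq m n. fourier_coeff m (f k) j * vilenkin m j x)" if "x \<in> Gm m" for x
      using f that \<open>n \<le> k\<close> unfolding vilenkin_martingale_def partial_sum_def by metis
    then have "fourier_coeff m (f n) i =
        fourier_coeff m (\<lambda>x. \<Sum>j<Mseq m n. fourier_coeff m (f k) j * vilenkin m j x) i"
      by (rule fourier_coeff_cong)
    then show ?thesis using i by (simp add: fourier_coeff_sum)
  qed
  then have "\<forall>\<^sub>F k in sequentially. fourier_coeff m (f k) i = fourier_coeff m (f n) i"
    unfolding eventually_sequentially by blast
  then show ?thesis
    unfolding mart_fourier_coeff_def by (intro limI[symmetric] tendsto_eventually)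
qed

lemma martingale_eq_sum:
  assumes f: "vilenkin_martingale m f" and x: "x \<in> Gm m"
  shows "f n x = (\<Sum>i<Mseq m n. mart_fourier_coeff m f i * vilenkin m i x)"
proof -
  have "f n x = partial_sum m (Mseq m n) (f n) x"
    using f x by (simp add: vilenkin_martingale_def)
  then show ?thesis by (simp add: partial_sum_def fourier_coeff_martingale[OF f])
qed

lemma mart_of_mart_partial_sum:
  "mart_of m (mart_partial_sum m k f) n x =
    (\<Sum>i<min (Mseq m n) k. mart_fourier_coeff m f i * vilenkin m i x)"
proof -
  have "mart_partial_sum m k f = (\<lambda>x. \<Sum>i<k. mart_fourier_coeff m f i * vilenkin m i x)"
    by (simp add: mart_partial_sum_def fun_eq_iff)
  then show ?thesis by (simp only: mart_of_def partial_sum_sum)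
qed

lemma measurable_mart_of [measurable]: "mart_of m g n \<in> borel_measurable (haar m)"
  unfolding mart_of_def partial_sum_def[abs_def] by measurable

text \<open>With g = f - S_(M_N) f, the martingale S_k f - f vanishes up to level N and equals u_k -
  g_n at later levels \<open>n\<close>, where u_k is the k-th partial sum of g_(N+1). Its maximal
  function is at most |u_k| + g^*; the first term costs the factor of
  \<open>nn_integral_partial_sum_le\<close>, the second the summand 1.\<close>

lemma nn_integral_max_fun_partial_sum_le:
  assumes p: "0 < p" "p < 1" and b: "\<And>k. m k \<le> b" and f: "vilenkin_martingale m f"
    and k: "Mseq m N \<le> k" "k \<le> Mseq m (Suc N)"
  shows "(\<integral>\<^sup>+x. epowr (max_fun (mart_of m (mart_partial_sum m k f) - f) x) p \<partial>haar m) \<le>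
    ennreal (real b powr p / (1 - 2 powr (p - 1)) * real (Mseq m (Suc N)) powr (1 - p) + 1) *
    (\<integral>\<^sup>+x. epowr (max_fun (f - mart_of m (mart_partial_sum m (Mseq m N) f)) x) p \<partial>haar m)"
proof -
  define g where "g = f - mart_of m (mart_partial_sum m (Mseq m N) f)"
  define c where "c i = mart_fourier_coeff m f i" for i
  \<comment> \<open>Coefficients of f - S_(M_N) f: cancelling the low frequencies makes
    \<open>u k\<close> a partial sum of \<open>u (Mseq m (Suc N))\<close>.\<close>
  define d where "d i = (if i < Mseq m N then 0 else c i)" for i
  define u where "u n x = (\<Sum>i<n. d i * vilenkin m i x)" for n x
  define K where "K = real b powr p / (1 - 2 powr (p - 1)) * real (Mseq m (Suc N)) powr (1 - p)"
  have K: "0 \<le> K" using powr_less_one[of 2 "p - 1"] p by (simp add: K_def)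
  have u: "u n x = (\<Sum>i<n. c i * vilenkin m i x) - (\<Sum>i<Mseq m N. c i * vilenkin m i x)"
    if "Mseq m N \<le> n" for n x
  proof -
    have "(\<Sum>i<n. c i * vilenkin m i x) =
        u n x + (\<Sum>i<n. if i < Mseq m N then c i * vilenkin m i x else 0)"
      unfolding u_def sum.distrib[symmetric] by (intro sum.cong) (auto simp: d_def)
    also have "(\<Sum>i<n. if i < Mseq m N then c i * vilenkin m i x else 0) =
        (\<Sum>i<Mseq m N. c i * vilenkin m i x)"
      using that by (intro sum.mono_neutral_cong_right) auto
    finally show ?thesis by simp
  qed
  have g: "g n x = u (Mseq m n) x" if "x \<in> Gm m" "Suc N \<le> n" for n x
    using that Mseq_mono[OF m, of N n]
    by (simp add: g_def martingale_eq_sum[OF f] mart_of_mart_partial_sum u c_def min_absorb2)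
  have meas_u [measurable]: "u n \<in> borel_measurable (haar m)" for n
    unfolding u_def[abs_def] by measurable
  have "f n \<in> borel_measurable (haar m)" for n
    using f by (auto simp: vilenkin_martingale_def intro: borel_measurable_integrable)
  then have meas_g [measurable]: "max_fun g \<in> borel_measurable (haar m)"
    unfolding max_fun_def[abs_def] g_def by (simp add: fun_diff_def)
  have "max_fun (mart_of m (mart_partial_sum m k f) - f) x \<le> ennreal (cmod (u k x)) + max_fun g x"
    if x: "x \<in> Gm m" for x
    unfolding max_fun_def[of "mart_of m (mart_partial_sum m k f) - f"]
  proof (rule SUP_least)
    fix n
    show "ennreal (cmod ((mart_of m (mart_partial_sum m k f) - f) n x)) \<le> ennreal (cmod (u k x)) + max_fun g x"
    proof (cases "n \<le> N")
      case True
      \<comment> \<open>All frequencies of level \<open>n\<close> lie below M_n \<le> k, so S_k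
        leaves this level unchanged.\<close>
      then have "Mseq m n \<le> k" using Mseq_mono[OF m True] k by linarith
      then show ?thesis using x by (simp add: martingale_eq_sum[OF f] mart_of_mart_partial_sum)
    next
      case False
      then have n: "Suc N \<le> n" by simp
      then have n': "Mseq m N \<le> Mseq m n" "k \<le> Mseq m n"
        using Mseq_mono[OF m, of N n] Mseq_mono[OF m n] k by linarith+
      have "(mart_of m (mart_partial_sum m k f) - f) n x = u k x - g n x"
        using x n' k by (simp add: martingale_eq_sum[OF f] mart_of_mart_partial_sum g[OF x n] u c_def min_absorb2)
      then have "ennreal (cmod ((mart_of m (mart_partial_sum m k f) - f) n x)) \<le>
          ennreal (cmod (u k x)) + ennreal (cmod (g n x))"
        by (simp add: norm_triangle_ineq4 ennreal_leI flip: ennreal_plus)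
      also have "\<dots> \<le> ennreal (cmod (u k x)) + max_fun g x"
        unfolding max_fun_def by (intro add_left_mono SUP_upper) simp
      finally show ?thesis .
    qed
  qed
  then have "epowr (max_fun (mart_of m (mart_partial_sum m k f) - f) x) p \<le>
      ennreal (cmod (u k x) powr p) + epowr (max_fun g x) p" if "x \<in> Gm m" for x
    using p that epowr_mono[of p _ "ennreal (cmod (u k x)) + max_fun g x"]
      epowr_add_le[of p "ennreal (cmod (u k x))" "max_fun g x"]
    by (auto simp: epowr_ennreal intro: order_trans)
  then have "(\<integral>\<^sup>+x. epowr (max_fun (mart_of m (mart_partial_sum m k f) - f) x) p \<partial>haar m) \<le>
      (\<integral>\<^sup>+x. ennreal (cmod (u k x) powr p) + epowr (max_fun g x) p \<partial>haar m)"
    by (intro nn_integral_mono) (simp add: space_haar)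
  also have "\<dots> = (\<integral>\<^sup>+x. ennreal (cmod (u k x) powr p) \<partial>haar m) + (\<integral>\<^sup>+x. epowr (max_fun g x) p \<partial>haar m)"
    by (intro nn_integral_add) measurable
  also have "(\<integral>\<^sup>+x. ennreal (cmod (u k x) powr p) \<partial>haar m) \<le>
      ennreal K * (\<integral>\<^sup>+x. ennreal (cmod (u (Mseq m (Suc N)) x) powr p) \<partial>haar m)"
    unfolding K_def u_def using p b k(2) by (rule nn_integral_partial_sum_le)
  also have "(\<integral>\<^sup>+x. ennreal (cmod (u (Mseq m (Suc N)) x) powr p) \<partial>haar m) \<le>
      (\<integral>\<^sup>+x. epowr (max_fun g x) p \<partial>haar m)"
  proof (rule nn_integral_mono)
    fix x assume "x \<in> space (haar m)"
    then have "ennreal (cmod (u (Mseq m (Suc N)) x)) = ennreal (cmod (g (Suc N) x))"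
      by (simp add: g space_haar)
    also have "\<dots> \<le> max_fun g x" unfolding max_fun_def by (rule SUP_upper) simp
    finally have "epowr (ennreal (cmod (u (Mseq m (Suc N)) x))) p \<le> epowr (max_fun g x) p"
      using p by (intro epowr_mono) auto
    then show "ennreal (cmod (u (Mseq m (Suc N)) x) powr p) \<le> epowr (max_fun g x) p"
      by (simp only: epowr_ennreal norm_ge_zero)
  qed
  finally have "(\<integral>\<^sup>+x. epowr (max_fun (mart_of m (mart_partial_sum m k f) - f) x) p \<partial>haar m) \<le>
      ennreal K * (\<integral>\<^sup>+x. epowr (max_fun g x) p \<partial>haar m) + (\<integral>\<^sup>+x. epowr (max_fun g x) p \<partial>haar m)"
    by (simp add: add_right_mono mult_left_mono)
  also have "\<dots> = ennreal (K + 1) * (\<integral>\<^sup>+x. epowr (max_fun g x) p \<partial>haar m)"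
    using K by (simp add: ennreal_plus distrib_right)
  finally show ?thesis by (simp only: K_def g_def)
qed

section \<open>Convergence of the partial sums in the Hardy norm\<close>

lemma ex_Mseq_bracket:
  assumes "1 \<le> k"
  shows "\<exists>N. Mseq m N \<le> k \<and> k < Mseq m (Suc N)"
  using ex_least_nat_less[of "\<lambda>N. k < Mseq m N" k] Mseq_gt[OF m, of k] assms by (auto simp: not_less)

lemma partial_sums_tendsto:
  assumes p: "0 < p" "p < 1" and f: "f \<in> Hp m p"
    and o: "ennreal_smallo (Hp_modulus m p f) (\<lambda>n. 1 / real (Mseq m n) powr (1 / p - 1))"
  shows "(\<lambda>k. Hp_norm m p (mart_of m (mart_partial_sum m k f) - f)) \<longlonglongrightarrow> 0"
proof -
  obtain b where b: "\<And>k. m k \<le> b" using m by (auto simp: generating_seq_def)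
  have mf: "vilenkin_martingale m f" using f by (simp add: Hp_def)
  define C where "C = real b powr p / (1 - 2 powr (p - 1))"
  \<comment> \<open>Upper bound for the loss factor once M_(N+1) \<le> b M_N has been used and
    M_N^(1-p) has been cancelled against the rate; the summand 1 absorbs M_N^(p-1) \<le> 1.\<close>
  define D where "D = C * real b powr (1 - p) + 1"
  have C: "0 \<le> C" using powr_less_one[of 2 "p - 1"] p by (simp add: C_def)
  have D: "1 \<le> D" using C by (simp add: D_def)
  have *: "\<forall>\<^sub>F k in sequentially. Hp_norm m p (mart_of m (mart_partial_sum m k f) - f) \<le> ennreal e"
    if e: "0 < e" for e :: real
  proof -
    \<comment> \<open>Chosen so that c^p D = e^p.\<close>
    define c where "c = e / D powr (1 / p)"
    have c: "0 < c" using e D by (simp add: c_def)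
    from o c obtain n0 where n0: "\<And>n. n0 \<le> n \<Longrightarrow>
        Hp_modulus m p f n \<le> ennreal (c * \<bar>1 / real (Mseq m n) powr (1 / p - 1)\<bar>)"
      unfolding ennreal_smallo_def eventually_sequentially by blast
    show ?thesis unfolding eventually_sequentially
    proof (intro exI allI impI)
      \<comment> \<open>Starting at M_(n0) forces the index \<open>N\<close> of the bracket around
        \<open>k\<close> to be at least \<open>n0\<close>, where the hypothesis on the modulus
        applies.\<close>
      fix k assume k: "Mseq m n0 \<le> k"
      then have "1 \<le> k" using Mseq_pos[OF m, of n0] by linarith
      then obtain N where N: "Mseq m N \<le> k" "k < Mseq m (Suc N)" using ex_Mseq_bracket by blast
      have "n0 \<le> N"
      proof (rule ccontr)
        assume "\<not> n0 \<le> N"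
        then have "Mseq m (Suc N) \<le> Mseq m n0" by (intro Mseq_mono[OF m]) simp
        with k N show False by linarith
      qed
      define M where "M = real (Mseq m N)"
      have M: "1 \<le> M" using Mseq_pos[OF m, of N] by (simp add: M_def Suc_le_eq)
      let ?g = "f - mart_of m (mart_partial_sum m (Mseq m N) f)"
      have "ennreal (c * \<bar>1 / M powr (1 / p - 1)\<bar>) = epowr (ennreal (c powr p * M powr (p - 1))) (1 / p)"
        using p c M by (simp add: epowr_ennreal powr_mult powr_powr diff_divide_distrib flip: powr_minus_divide)
      then have "Lp_norm m p (max_fun ?g) \<le> epowr (ennreal (c powr p * M powr (p - 1))) (1 / p)"
        using n0[OF \<open>n0 \<le> N\<close>] by (simp only: Hp_modulus_def Hp_norm_def M_def)
      then have g: "(\<integral>\<^sup>+x. epowr (max_fun ?g x) p \<partial>haar m) \<le> ennreal (c powr p * M powr (p - 1))"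
        using p by (simp only: Lp_norm_le_iff)
      have "real (Mseq m (Suc N)) powr (1 - p) \<le> (real b * M) powr (1 - p)"
        using p b[of N] by (intro powr_mono2) (auto simp: M_def intro!: mult_right_mono)
      then have "(C * real (Mseq m (Suc N)) powr (1 - p) + 1) * (c powr p * M powr (p - 1)) \<le>
          (C * (real b powr (1 - p) * M powr (1 - p)) + 1) * (c powr p * M powr (p - 1))"
        using C M by (intro mult_right_mono add_right_mono mult_left_mono) (simp_all add: powr_mult)
      also have "\<dots> = c powr p * (C * real b powr (1 - p) * (M powr (1 - p) * M powr (p - 1)) + M powr (p - 1))"
        by (simp add: algebra_simps)
      \<comment> \<open>The assumed rate, raised to the power p, compensates exactly the growth of
        the loss factor.\<close>
      also have "M powr (1 - p) * M powr (p - 1) = 1" using M by (simp flip: powr_add)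
      also have "c powr p * (C * real b powr (1 - p) * 1 + M powr (p - 1)) \<le> c powr p * D"
      proof -
        have "M powr (p - 1) \<le> M powr 0" using M p by (intro powr_mono) auto
        then show ?thesis using M by (intro mult_left_mono) (simp_all add: D_def)
      qed
      also have "c powr p * D = e powr p"
        using e D p by (simp add: c_def powr_divide powr_powr)
      finally have le: "(C * real (Mseq m (Suc N)) powr (1 - p) + 1) * (c powr p * M powr (p - 1)) \<le> e powr p" .
      have "(\<integral>\<^sup>+x. epowr (max_fun (mart_of m (mart_partial_sum m k f) - f) x) p \<partial>haar m) \<le>
          ennreal (C * real (Mseq m (Suc N)) powr (1 - p) + 1) * (\<integral>\<^sup>+x. epowr (max_fun ?g x) p \<partial>haar m)"
        unfolding C_def using N by (intro nn_integral_max_fun_partial_sum_le[OF p b mf]) auto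
      also have "\<dots> \<le> ennreal (C * real (Mseq m (Suc N)) powr (1 - p) + 1) * ennreal (c powr p * M powr (p - 1))"
        by (intro mult_left_mono g) simp
      also have "\<dots> = ennreal ((C * real (Mseq m (Suc N)) powr (1 - p) + 1) * (c powr p * M powr (p - 1)))"
        using C by (intro ennreal_mult[symmetric]) auto
      also have "\<dots> \<le> ennreal (e powr p)" by (rule ennreal_leI[OF le])
      finally have "Hp_norm m p (mart_of m (mart_partial_sum m k f) - f) \<le> epowr (ennreal (e powr p)) (1 / p)"
        unfolding Hp_norm_def using p by (simp only: Lp_norm_le_iff)
      also have "\<dots> = ennreal e" using p e by (simp add: epowr_ennreal powr_powr)
      finally show "Hp_norm m p (mart_of m (mart_partial_sum m k f) - f) \<le> ennreal e" .
    qed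
  qed
  show ?thesis
  proof (rule order_tendstoI)
    \<comment> \<open>The neighbourhood bound \<open>a\<close> may be infinite, so a finite positive
      \<open>e\<close> below it is picked first.\<close>
    fix a :: ennreal assume "0 < a"
    then obtain e where e: "0 < e" "ennreal e < a"
    proof -
      obtain c where c: "0 < c" "c < a" using \<open>0 < a\<close> dense by blast
      then have "c = ennreal (enn2real c)" by (metis ennreal_enn2real less_top order_less_trans)
      with c that[of "enn2real c"] show ?thesis by (metis ennreal_less_zero_iff)
    qed
    show "\<forall>\<^sub>F k in sequentially. Hp_norm m p (mart_of m (mart_partial_sum m k f) - f) < a"
      using *[OF e(1)] by (rule eventually_mono) (use e(2) in simp)
  qed simp
qed

section \<open>The unit mass at the origin\<close>

text \<open>Written as a character sum, so that all coefficients are visibly 1;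
  \<open>unit_mass_eq\<close> recovers the closed form from the Dirichlet kernel with second
  argument 0.\<close>

definition unit_mass :: "nat \<Rightarrow> (nat \<Rightarrow> nat) \<Rightarrow> complex" where
  "unit_mass n x = (\<Sum>i<Mseq m n. vilenkin m i x)"

lemma unit_mass_eq:
  assumes "x \<in> Gm m"
  shows "unit_mass n x = (if x \<in> cyl m n (\<lambda>_. 0) then of_nat (Mseq m n) else 0)"
  using dkernel_Mseq[OF m assms zero_in_Gm, of n] assms
  by (simp add: unit_mass_def dkernel_def cyl_def)

lemma unit_mass_martingale: "vilenkin_martingale m unit_mass"
  unfolding vilenkin_martingale_def
proof (intro conjI allI impI ballI)
  fix n
  show "integrable (haar m) (unit_mass n)"
    unfolding unit_mass_def[abs_def]
    \<comment> \<open>The character of index 0 is constantly 1, so the integrability of products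
      covers single characters.\<close>
    using integrable_vilenkin_mult[of 1 _ 0] vilenkin_eq_prod[OF m, of 0 0]
    by (intro Bochner_Integration.integrable_sum) simp
  have space: "space (Filt m n) = Gm m" and sets: "cyl m n (\<lambda>_. 0) \<in> sets (Filt m n)"
  proof -
    have sub: "cyl m n ` Gm m \<subseteq> Pow (Gm m)" by (auto simp: cyl_def)
    show "space (Filt m n) = Gm m" unfolding Filt_def by (rule space_measure_of[OF sub])
    show "cyl m n (\<lambda>_. 0) \<in> sets (Filt m n)"
      unfolding Filt_def using zero_in_Gm by (intro in_measure_of[OF sub] imageI)
  qed
  have "(\<lambda>x. indicator (cyl m n (\<lambda>_. 0)) x * of_nat (Mseq m n) :: complex) \<in> borel_measurable (Filt m n)"
    using sets by measurable
  then show "unit_mass n \<in> borel_measurable (Filt m n)"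
    by (rule measurable_cong[THEN iffD1, rotated]) (simp add: space unit_mass_eq)
next
  fix n k x assume "n \<le> (k::nat)"
  then show "partial_sum m (Mseq m n) (unit_mass k) x = unit_mass n x"
    using partial_sum_sum[of "Mseq m n" "\<lambda>_. 1" "Mseq m k" x] Mseq_mono[OF m, of n k]
    by (simp add: unit_mass_def[abs_def] min_absorb1)
qed

lemma mart_fourier_coeff_unit_mass: "mart_fourier_coeff m unit_mass i = 1"
proof -
  have "mart_fourier_coeff m unit_mass i = fourier_coeff m (unit_mass i) i"
    using fourier_coeff_martingale[OF unit_mass_martingale Mseq_gt[OF m]] by simp
  then show ?thesis
    using fourier_coeff_sum[of "\<lambda>_. 1" "Mseq m i" i] Mseq_gt[OF m, of i]
    by (simp add: unit_mass_def[abs_def])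
qed

text \<open>The p-th power of the maximal function is dominated by the sum over s \<ge> N of M_s^p
  on I_s(0). These sets have measure 1 / M_s, which leaves the geometric tail from \<open>N\<close>
  on. The case N = 0 gives membership in \<open>Hp\<close>, the case N = n the modulus of
  continuity.\<close>

lemma nn_integral_max_fun_le:
  assumes p: "0 < p" "p < 1"
    and g: "\<And>n x. x \<in> Gm m \<Longrightarrow> g n x = 0 \<or> (\<exists>s\<ge>N. x \<in> cyl m s (\<lambda>_. 0) \<and> cmod (g n x) \<le> real (Mseq m s))"
  shows "(\<integral>\<^sup>+x. epowr (max_fun g x) p \<partial>haar m) \<le>
    ennreal (1 / (1 - 2 powr (p - 1)) * real (Mseq m N) powr (p - 1))"
proof -
  let ?R = "\<lambda>x. \<Sum>s. ennreal (real (Mseq m (N + s)) powr p) * indicator (cyl m (N + s) (\<lambda>_. 0)) x"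
  have "(\<integral>\<^sup>+x. epowr (max_fun g x) p \<partial>haar m) \<le> (\<integral>\<^sup>+x. ?R x \<partial>haar m)"
  proof (intro nn_integral_mono epowr_max_fun_le p)
    fix x n assume "x \<in> space (haar m)"
    then consider "g n x = 0" | s where "N \<le> s" "x \<in> cyl m s (\<lambda>_. 0)" "cmod (g n x) \<le> real (Mseq m s)"
      using g[of x n] by (auto simp: space_haar)
    then show "ennreal (cmod (g n x) powr p) \<le> ?R x"
    proof cases
      case 2
      define t where "t = s - N"
      have "ennreal (cmod (g n x) powr p) \<le>
          ennreal (real (Mseq m (N + t)) powr p) * indicator (cyl m (N + t) (\<lambda>_. 0)) x"
        using 2 p by (simp add: t_def ennreal_leI powr_mono2)
      also have "\<dots> \<le> ?R x" by (rule le_suminf_ennreal)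
      finally show ?thesis .
    qed simp
  qed
  also have "\<dots> = (\<Sum>s. \<integral>\<^sup>+x. ennreal (real (Mseq m (N + s)) powr p) * indicator (cyl m (N + s) (\<lambda>_. 0)) x \<partial>haar m)"
    by (rule nn_integral_suminf) (use haar_cyl(1)[OF zero_in_Gm] in measurable)
  also have "\<dots> = (\<Sum>s. ennreal (real (Mseq m (N + s)) powr (p - 1)))"
    using Mseq_pos[OF m] by (intro suminf_cong)
       (simp add: nn_integral_cmult_indicator haar_cyl[OF zero_in_Gm] powr_diff ennreal_mult[symmetric])
  also have "\<dots> \<le> ennreal (1 / (1 - 2 powr (p - 1)) * real (Mseq m N) powr (p - 1))"
    by (rule suminf_Mseq_powr_le[OF p(2)])
  finally show ?thesis .
qed

lemma unit_mass_in_Hp: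
  assumes p: "0 < p" "p < 1"
  shows "unit_mass \<in> Hp m p"
proof -
  have "(\<integral>\<^sup>+x. epowr (max_fun unit_mass x) p \<partial>haar m) \<le>
      ennreal (1 / (1 - 2 powr (p - 1)) * real (Mseq m 0) powr (p - 1))"
  proof (rule nn_integral_max_fun_le[OF p])
    fix n x assume "x \<in> Gm m"
    then show "unit_mass n x = 0 \<or> (\<exists>s\<ge>0. x \<in> cyl m s (\<lambda>_. 0) \<and> cmod (unit_mass n x) \<le> real (Mseq m s))"
      by (auto simp: unit_mass_eq)
  qed
  then have "Hp_norm m p unit_mass \<le> epowr (ennreal (1 / (1 - 2 powr (p - 1)) * real (Mseq m 0) powr (p - 1))) (1 / p)"
    unfolding Hp_norm_def using p by (simp only: Lp_norm_le_iff)
  also have "\<dots> < \<infinity>" by (simp add: epowr_def)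
  finally show ?thesis by (simp add: Hp_def unit_mass_martingale)
qed

text \<open>The difference vanishes up to level \<open>n\<close>. At a later level \<open>l\<close>
  it is at most M_l on I_l(0), at most M_n on the rest of I_n(0), and zero elsewhere; the p-th root
  of M_n^(p-1) is the claimed rate.\<close>

lemma unit_mass_modulus:
  assumes p: "0 < p" "p < 1"
  shows "ennreal_bigo (Hp_modulus m p unit_mass) (\<lambda>n. 1 / real (Mseq m n) powr (1 / p - 1))"
proof -
  define G where "G = 1 / (1 - 2 powr (p - 1) :: real)"
  have G: "0 < G" using powr_less_one[of 2 "p - 1"] p by (simp add: G_def)
  have "Hp_modulus m p unit_mass n \<le> ennreal (G powr (1 / p) * \<bar>1 / real (Mseq m n) powr (1 / p - 1)\<bar>)" for n
  proof -
    let ?g = "unit_mass - mart_of m (mart_partial_sum m (Mseq m n) unit_mass)"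
    \<comment> \<open>Projecting S_(M_n) f to level \<open>l\<close> keeps the frequencies below
      both M_l and M_n, hence the minimum.\<close>
    have g: "?g l x = unit_mass l x - unit_mass (min l n) x" for l x
      using Mseq_mono[OF m, of l n] Mseq_mono[OF m, of n l]
      by (cases "l \<le> n")
         (auto simp: mart_of_mart_partial_sum mart_fourier_coeff_unit_mass unit_mass_def min_absorb1 min_absorb2)
    have "(\<integral>\<^sup>+x. epowr (max_fun ?g x) p \<partial>haar m) \<le> ennreal (G * real (Mseq m n) powr (p - 1))"
      unfolding G_def
    proof (rule nn_integral_max_fun_le[OF p])
      fix l x assume x: "x \<in> Gm m"
      show "?g l x = 0 \<or> (\<exists>s\<ge>n. x \<in> cyl m s (\<lambda>_. 0) \<and> cmod (?g l x) \<le> real (Mseq m s))"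
      proof (cases "l \<le> n")
        case False
        then have M: "Mseq m n \<le> Mseq m l" and n: "n \<le> l" using Mseq_mono[OF m, of n l] by auto
        have sub: "cyl m l (\<lambda>_. 0) \<subseteq> cyl m n (\<lambda>_. 0)" using n by (auto simp: cyl_def)
        consider "x \<in> cyl m l (\<lambda>_. 0)" | "x \<in> cyl m n (\<lambda>_. 0)" "x \<notin> cyl m l (\<lambda>_. 0)"
          | "x \<notin> cyl m n (\<lambda>_. 0)" "x \<notin> cyl m l (\<lambda>_. 0)" using sub by blast
        then show ?thesis
        proof cases
          case 1
          then have "?g l x = of_nat (Mseq m l - Mseq m n)"
            using n M sub x unfolding g by (auto simp: unit_mass_eq min_absorb2 of_nat_diff)
          then have "cmod (?g l x) \<le> real (Mseq m l)" by (simp only: norm_of_nat of_nat_le_iff diff_le_self)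
          with 1 n show ?thesis by blast
        next
          case 2
          then have "cmod (?g l x) \<le> real (Mseq m n)"
            using n x unfolding g by (simp add: unit_mass_eq min_absorb2)
          with 2 show ?thesis by blast
        next
          case 3
          then show ?thesis using n x unfolding g by (simp add: unit_mass_eq min_absorb2)
        qed
      qed (simp only: g min_absorb1 diff_self simp_thms)
    qed
    then have "Hp_modulus m p unit_mass n \<le> epowr (ennreal (G * real (Mseq m n) powr (p - 1))) (1 / p)"
      unfolding Hp_modulus_def Hp_norm_def using p by (simp only: Lp_norm_le_iff)
    also have "\<dots> = ennreal (G powr (1 / p) * \<bar>1 / real (Mseq m n) powr (1 / p - 1)\<bar>)"
      using p G by (simp add: epowr_ennreal powr_mult powr_powr diff_divide_distrib flip: powr_minus_divide)
    finally show ?thesis .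
  qed
  then show ?thesis
    unfolding ennreal_bigo_def using G by (intro exI[of _ "G powr (1 / p)"]) simp
qed

text \<open>The bound combines the threshold 1/2, which lies below the modulus 1 of the surviving
  character, with a set of measure at least 1/2.\<close>

lemma weak_norm_unit_mass_ge:
  assumes p: "0 < p" and n: "1 \<le> n"
  shows "ennreal (1 / 2 * (1 / 2) powr (1 / p)) \<le>
    mart_weak_Lp_norm m p (mart_of m (mart_partial_sum m (Mseq m n + 1) unit_mass) - unit_mass)"
proof -
  let ?d = "mart_of m (mart_partial_sum m (Mseq m n + 1) unit_mass) - unit_mass"
  \<comment> \<open>Level n + 1 already contains the frequency M_n, because M_n + 1 \<le>
    M_(n+1).\<close>
  let ?A = "{x \<in> Gm m. 1 / 2 < cmod (?d (Suc n) x)}"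
  let ?I = "cyl m n (\<lambda>_. 0)"
  have two: "2 * Mseq m k \<le> Mseq m (Suc k)" for k
    using m by (simp add: generating_seq_def)
  have M: "Mseq m n + 1 \<le> Mseq m (Suc n)" using two[of n] Mseq_pos[OF m, of n] by linarith
  \<comment> \<open>As n \<ge> 1, I_n(0) has measure at most 1/2, so its complement carries at least
    half of the mass.\<close>
  have M2: "2 \<le> Mseq m n"
    using Mseq_mono[OF m n] two[of 0] by simp
  have "cmod (?d (Suc n) x) = 1" if x: "x \<in> Gm m" "x \<notin> ?I" for x
  proof -
    have "cyl m (Suc n) (\<lambda>_. 0) \<subseteq> ?I" by (auto simp: cyl_def)
    then have "x \<notin> cyl m (Suc n) (\<lambda>_. 0)" using x by blast
    then have "unit_mass (Suc n) x = 0" "unit_mass n x = 0" using x by (simp_all add: unit_mass_eq)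
    moreover have "?d (Suc n) x = unit_mass n x + vilenkin m (Mseq m n) x - unit_mass (Suc n) x"
      using M by (simp add: mart_of_mart_partial_sum mart_fourier_coeff_unit_mass min_absorb2 del: Mseq.simps)
        (simp add: unit_mass_def)
    ultimately show ?thesis by simp
  qed
  then have sub: "Gm m - ?I \<subseteq> ?A" by auto
  have [measurable]: "unit_mass k \<in> borel_measurable (haar m)" for k
    unfolding unit_mass_def[abs_def] by measurable
  have "?d (Suc n) \<in> borel_measurable (haar m)"
    unfolding minus_apply fun_diff_def by measurable
  then have A: "?A \<in> sets (haar m)"
    unfolding space_haar[symmetric] by measurable
  have I: "?I \<in> sets (haar m)" by (rule haar_cyl(1)[OF zero_in_Gm])
  have "1 / real (Mseq m n) \<le> 1 / 2" using M2 by (simp add: divide_simps)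
  then have "1 / 2 \<le> measure (haar m) (space (haar m) - ?I)"
    using haar.prob_compl[OF I] measure_cyl[OF zero_in_Gm, of n] by simp
  also have "\<dots> \<le> measure (haar m) ?A"
    using A sub by (intro haar.finite_measure_mono) (auto simp: space_haar)
  finally have le: "ennreal (1 / 2) \<le> emeasure (haar m) ?A"
    by (simp only: haar.emeasure_eq_measure ennreal_leI)
  have "ennreal (1 / 2 * (1 / 2) powr (1 / p)) = ennreal (1 / 2) * epowr (ennreal (1 / 2)) (1 / p)"
    by (subst epowr_ennreal) (simp_all only: ennreal_mult powr_ge_zero zero_le_divide_1_iff zero_le_numeral)
  also have "\<dots> \<le> ennreal (1 / 2) * epowr (emeasure (haar m) ?A) (1 / p)"
    using p by (intro mult_left_mono epowr_mono le) auto
  also have "\<dots> \<le> weak_Lp_norm m p (?d (Suc n))"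
    unfolding weak_Lp_norm_def by (rule SUP_upper) simp
  also have "\<dots> \<le> mart_weak_Lp_norm m p ?d"
    unfolding mart_weak_Lp_norm_def by (rule SUP_upper) simp
  finally show ?thesis .
qed

lemma unit_mass_partial_sums_not_tendsto:
  assumes "0 < p"
  shows "\<not> (\<lambda>k. mart_weak_Lp_norm m p (mart_of m (mart_partial_sum m k unit_mass) - unit_mass)) \<longlonglongrightarrow> 0"
proof
  assume "(\<lambda>k. mart_weak_Lp_norm m p (mart_of m (mart_partial_sum m k unit_mass) - unit_mass)) \<longlonglongrightarrow> 0"
  moreover have "0 < ennreal (1 / 2 * (1 / 2) powr (1 / p))" by simp
  ultimately have "\<forall>\<^sub>F k in sequentially.
      mart_weak_Lp_norm m p (mart_of m (mart_partial_sum m k unit_mass) - unit_mass) <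
      ennreal (1 / 2 * (1 / 2) powr (1 / p))"
    by (rule order_tendstoD(2))
  then obtain K where K: "\<And>k. K \<le> k \<Longrightarrow>
      mart_weak_Lp_norm m p (mart_of m (mart_partial_sum m k unit_mass) - unit_mass) <
      ennreal (1 / 2 * (1 / 2) powr (1 / p))"
    unfolding eventually_sequentially by blast
  \<comment> \<open>The orders M_n + 1 are unbounded; taking n = K + 1 also guarantees n \<ge>
    1.\<close>
  have "K \<le> Mseq m (Suc K) + 1" using Mseq_gt[OF m, of "Suc K"] by linarith
  from K[OF this] weak_norm_unit_mass_ge[OF assms, of "Suc K"] show False by simp
qed

end

theorem theorem2p23:
  fixes m :: "nat \<Rightarrow> nat"
  assumes "generating_seq m"
  shows
    "(\<forall>p f. 0 < p \<longrightarrow> p < 1 \<longrightarrow> f \<in> Hp m p \<longrightarrow>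
        ennreal_smallo (Hp_modulus m p f) (\<lambda>n. 1 / real (Mseq m n) powr (1 / p - 1)) \<longrightarrow>
        (\<lambda>k. Hp_norm m p (mart_of m (mart_partial_sum m k f) - f)) \<longlonglongrightarrow> 0) \<and>
     (\<forall>p. 0 < p \<longrightarrow> p < 1 \<longrightarrow>
        (\<exists>f\<in>Hp m p.
          ennreal_bigo (Hp_modulus m p f) (\<lambda>n. 1 / real (Mseq m n) powr (1 / p - 1)) \<and>
          \<not> (\<lambda>k. mart_weak_Lp_norm m p (mart_of m (mart_partial_sum m k f) - f)) \<longlonglongrightarrow> 0))"
proof -
  interpret vilenkin_system m by standard (rule assms)
  show ?thesis
    using partial_sums_tendsto unit_mass_in_Hp unit_mass_modulus unit_mass_partial_sums_not_tendsto by blast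
qed

end
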